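(* Let $V=(v^{(m)})_{m\in\mathbb{N}}$ be a decreasing sequence of strictly positive weights, let $p\in\{0\}\cup[1,\infty)$, and suppose that the backward shift $B$ is continuous on $k_p(V)$. Then the following are equivalent. (i) $B$ has a periodic point $x\in k_p(V)$, $x\neq0$. (ii) There is $m\in\mathbb{N}$ such that $v^{(m)}\in\ell_p$ (respectively, $v^{(m)}\in c_0$ when $p=0$). (iii) $B$ is chaotic, mixing, and sequentially hypercyclic on $k_p(V)$. (iv) $B$ is chaotic on $k_p(V)$. In particular, $B$ is sequentially hypercyclic whenever $B$ is chaotic.
   Context: $\mathbb{N}=\{1,2,\dots\}$, $\mathbb{K}\in\{\mathbb{R},\mathbb{C}\}$, $\omega=\mathbb{K}^{\mathbb{N}}$. Köthe coechelon spaces: a decreasing sequence of strictly positive weights is $V=(v^{(m)})_{m\in\mathbb{N}}$ with $v^{(m)}=(v^{(m)}_j)_{j\in\mathbb{N}}\in(0,\infty)^{\mathbb{N}}$ and $v^{(m)}_j\ge v^{(m+1)}_j$ for all $m,j$. For $1\le p<\infty$, $\ell_p(v^{(m)})=\{x\in\omega: (x_jv^{(m)}_j)_j\in\ell_p\}$ with norm $\|(x_jv_j^{(m)})_j\|_{\ell_p}$, and $c_0(v^{(m)})=\{x\in\omega:(x_jv^{(m)}_j)_j\in c_0\}$ with norm $\sup_j|x_j|v^{(m)}_j$. These are Banach spaces increasing in $m$; $k_p(V)$ is the locally convex inductive limit $\bigcup_m\ell_p(v^{(m)})$ ($1\le p<\infty$), and $k_0(V)$ is the locally convex inductive limit $\bigcup_m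 c_0(v^{(m)})$ (finest locally convex topology making all inclusions of the steps continuous). The backward shift is $B(x_j)_{j\in\mathbb{N}}=(x_{j+1})_{j\in\mathbb{N}}$. For a continuous linear operator $T$ on a topological vector space $E$ and non-empty open $U,W\subseteq E$, let $N_T(U,W)=\{n\in\mathbb{N}:T^n(U)\cap W\ne\emptyset\}$. $T$ is transitive if all $N_T(U,W)$ are non-empty and mixing if they are all cofinite. A point $x$ is periodic for $T$ if $T^Nx=x$ for some $N\in\mathbb{N}$. $T$ is chaotic if it is transitive and its set of periodic points is dense in $E$. $T$ is sequentially hypercyclic if some orbit $\{x,Tx,T^2x,\dots\}$ is sequentially dense, i.e. every element of $E$ is the limit of a sequence of elements of the orbit. *)

theory Defs
  imports "HOL-Analysis.Analysis"
begin

text \<open>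
  Sequences are functions on \<open>nat\<close>, so \<open>x 0\<close> is the first entry of \<open>x\<close> and \<open>V 0\<close> the
  first weight. Numbers of iterations (\<open>return_set\<close>, \<open>periodic_points\<close>) are not
  shifted: there the condition \<open>n \<ge> 1\<close> is explicit. The spaces are topologies on sets of
  sequences rather than types, since their carriers depend on the weights.

  The scalars are a type \<open>'k\<close> of class \<open>real_normed_field\<close>. With \<open>euclidean_space\<close> added,
  such a type is isometrically isomorphic to \<open>real\<close> or \<open>complex\<close>, and both are instances.
\<close>

definition decreasing_weights :: "(nat \<Rightarrow> nat \<Rightarrow> real) \<Rightarrow> bool" where
  "decreasing_weights V \<longleftrightarrow> (\<forall>m j. 0 < V m j) \<and> (\<forall>m j. V (Suc m) j \<le> V m j)"

text \<open>The exponent \<open>p = 0\<close> stands for \<open>c\<^sub>0\<close>.\<close>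

definition lp_space :: "real \<Rightarrow> (nat \<Rightarrow> 'a::real_normed_vector) set" where
  "lp_space p = (if p = 0 then {x. x \<longlonglongrightarrow> 0} else {x. summable (\<lambda>j. norm (x j) powr p)})"

definition lp_norm :: "real \<Rightarrow> (nat \<Rightarrow> 'a::real_normed_vector) \<Rightarrow> real" where
  "lp_norm p x = (if p = 0 then (SUP j. norm (x j)) else (\<Sum>j. norm (x j) powr p) powr (1 / p))"

definition weighted :: "(nat \<Rightarrow> real) \<Rightarrow> (nat \<Rightarrow> 'a::real_normed_vector) \<Rightarrow> nat \<Rightarrow> 'a" where
  "weighted v x = (\<lambda>j. v j *\<^sub>R x j)"

definition weighted_lp :: "real \<Rightarrow> (nat \<Rightarrow> real) \<Rightarrow> (nat \<Rightarrow> 'a::real_normed_vector) set" where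
  "weighted_lp p v = {x. weighted v x \<in> lp_space p}"

text \<open>
  The case distinction is needed because \<open>Metric_space\<close> requires nonnegative distances for all
  elements of the type, and \<open>lp_norm 0\<close> is unspecified on unbounded sequences.
\<close>

definition weighted_lp_dist ::
    "real \<Rightarrow> (nat \<Rightarrow> real) \<Rightarrow> (nat \<Rightarrow> 'a::real_normed_vector) \<Rightarrow> (nat \<Rightarrow> 'a) \<Rightarrow> real" where
  "weighted_lp_dist p v x y =
     (if x \<in> weighted_lp p v \<and> y \<in> weighted_lp p v
      then lp_norm p (weighted v (\<lambda>j. x j - y j)) else 0)"

definition weighted_lp_topology ::
    "real \<Rightarrow> (nat \<Rightarrow> real) \<Rightarrow> (nat \<Rightarrow> 'a::real_normed_vector) topology" where
  "weighted_lp_topology p v = Metric_space.mtopology (weighted_lp p v) (weighted_lp_dist p v)"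

definition seq_subspace :: "(nat \<Rightarrow> 'k::real_normed_field) set \<Rightarrow> bool" where
  "seq_subspace E \<longleftrightarrow> (\<lambda>_. 0) \<in> E \<and> (\<forall>x\<in>E. \<forall>y\<in>E. (\<lambda>j. x j + y j) \<in> E) \<and>
     (\<forall>c. \<forall>x\<in>E. (\<lambda>j. c * x j) \<in> E)"

definition seq_convex :: "(nat \<Rightarrow> 'k::real_normed_field) set \<Rightarrow> bool" where
  "seq_convex C \<longleftrightarrow>
     (\<forall>x\<in>C. \<forall>y\<in>C. \<forall>t\<in>{0..1::real}. (\<lambda>j. (1 - t) *\<^sub>R x j + t *\<^sub>R y j) \<in> C)"

definition locally_convex_topology :: "(nat \<Rightarrow> 'k::real_normed_field) topology \<Rightarrow> bool" where
  "locally_convex_topology X \<longleftrightarrow>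
     seq_subspace (topspace X) \<and>
     continuous_map (prod_topology X X) X (\<lambda>(x, y) j. x j + y j) \<and>
     continuous_map (prod_topology euclidean X) X (\<lambda>(c, x) j. c * x j) \<and>
     (\<forall>U. openin X U \<and> (\<lambda>_. 0) \<in> U \<longrightarrow>
        (\<exists>C\<subseteq>U. seq_convex C \<and> (\<lambda>_. 0) \<in> X interior_of C))"

definition admissible_topology ::
    "(nat \<Rightarrow> (nat \<Rightarrow> 'k::real_normed_field) topology) \<Rightarrow> (nat \<Rightarrow> 'k) topology \<Rightarrow> bool" where
  "admissible_topology E X \<longleftrightarrow>
     topspace X = (\<Union>m. topspace (E m)) \<and> locally_convex_topology X \<and>
     (\<forall>m. continuous_map (E m) X (\<lambda>x. x))"

text \<open>
  The supremum of all locally convex topologies on the union for which the inclusions of the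
  steps are continuous; \<open>admissible_lc_inductive_limit\<close> and \<open>lc_inductive_limit_finest\<close>
  below show that it is the finest such topology.
\<close>

definition lc_inductive_limit ::
    "(nat \<Rightarrow> (nat \<Rightarrow> 'k::real_normed_field) topology) \<Rightarrow> (nat \<Rightarrow> 'k) topology" where
  "lc_inductive_limit E =
     topology_generated_by {U. \<exists>X. admissible_topology E X \<and> openin X U}"

lemma lc_inductive_limit_finest:
  assumes "admissible_topology E X" and "openin X U"
  shows "openin (lc_inductive_limit E) U"
  unfolding lc_inductive_limit_def
  by (rule topology_generated_by_Basis) (use assms in blast)

lemma admissible_indiscrete:
  fixes E :: "nat \<Rightarrow> (nat \<Rightarrow> 'k::real_normed_field) topology"
  assumes "seq_subspace (\<Union>m. topspace (E m))"
  shows "admissible_topology E (topology_generated_by {\<Union>m. topspace (E m)})"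
proof -
  define S where "S = (\<Union>m. topspace (E m))"
  define X where "X = topology_generated_by {S}"
  have sub: "seq_subspace S" using assms by (simp add: S_def)
  have tX: "topspace X = S" by (simp add: X_def topology_generated_by_topspace)
  have nonempty_open: "U = S" if "generate_topology_on {S} U" "U \<noteq> {}" for U
    using that
  proof (induction rule: generate_topology_on.induct)
    case (UN K)
    then have "k = {} \<or> k = S" if "k \<in> K" for k using that by blast
    with UN(3) show ?case by auto
  qed auto
  have op: "U = S" if "openin X U" "U \<noteq> {}" for U
    using that nonempty_open by (simp add: X_def openin_topology_generated_by_iff)
  have cont: "continuous_map Y X f" if "f ` topspace Y \<subseteq> S" for f and Y :: "'z topology"
    unfolding continuous_map_def
  proof (intro conjI allI impI)
    show "f \<in> topspace Y \<rightarrow> topspace X" using that tX by auto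
    fix U assume "openin X U"
    then have "U = {} \<or> U = S" using op by blast
    then have "{x \<in> topspace Y. f x \<in> U} = {} \<or> {x \<in> topspace Y. f x \<in> U} = topspace Y"
      using that by auto
    then show "openin Y {x \<in> topspace Y. f x \<in> U}"
      by (metis openin_empty openin_topspace)
  qed
  have oS: "openin X S" using tX openin_topspace by metis
  have loc: "\<exists>C\<subseteq>U. seq_convex C \<and> (\<lambda>_. 0) \<in> X interior_of C"
    if "openin X U \<and> (\<lambda>_. 0) \<in> U" for U
  proof -
    have "U = S" using that op by blast
    moreover have "seq_convex S"
      unfolding seq_convex_def
    proof (intro ballI)
      fix x y t assume "x \<in> S" "y \<in> S"
      then have "(\<lambda>j. of_real (1 - t) * x j) \<in> S" "(\<lambda>j. of_real t * y j) \<in> S"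
        using sub unfolding seq_subspace_def by blast+
      then have "(\<lambda>j. of_real (1 - t) * x j + of_real t * y j) \<in> S"
        using sub unfolding seq_subspace_def by fast
      then show "(\<lambda>j. (1 - t) *\<^sub>R x j + t *\<^sub>R y j) \<in> S"
        by (simp add: scaleR_conv_of_real)
    qed
    moreover have "X interior_of S = S" using oS by (simp add: interior_of_openin)
    ultimately show ?thesis using that by auto
  qed
  have "locally_convex_topology X"
    unfolding locally_convex_topology_def tX
  proof (intro conjI)
    show "continuous_map (prod_topology X X) X (\<lambda>(x, y) j. x j + y j)"
      by (rule cont) (use sub in \<open>auto simp: seq_subspace_def tX\<close>)
    show "continuous_map (prod_topology euclidean X) X (\<lambda>(c, x) j. c * x j)"
      by (rule cont) (use sub in \<open>auto simp: seq_subspace_def tX\<close>)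
  qed (use loc sub in auto)
  moreover have "continuous_map (E m) X (\<lambda>x. x)" for m
    by (rule cont) (auto simp: S_def)
  ultimately show ?thesis
    using tX unfolding admissible_topology_def X_def S_def by auto
qed

lemma admissible_lc_inductive_limit:
  fixes E :: "nat \<Rightarrow> (nat \<Rightarrow> 'k::real_normed_field) topology"
  assumes sub: "seq_subspace (\<Union>m. topspace (E m))"
  shows "admissible_topology E (lc_inductive_limit E)"
proof -
  define S where "S = (\<Union>m. topspace (E m))"
  define B where "B = {U. \<exists>X. admissible_topology E X \<and> openin X U}"
  define L where "L = lc_inductive_limit E"
  have L: "L = topology_generated_by B" by (simp add: L_def B_def lc_inductive_limit_def)
  have tsp: "topspace X = S" if "admissible_topology E X" for X
    using that by (simp add: admissible_topology_def S_def)
  have UB: "\<Union>B = S"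
  proof
    show "\<Union>B \<subseteq> S" using tsp openin_subset unfolding B_def by fastforce
    show "S \<subseteq> \<Union>B" using admissible_indiscrete[OF sub] tsp openin_topspace unfolding B_def by blast
  qed
  have tL: "topspace L = S" by (simp add: L topology_generated_by_topspace UB)
  have idc: "continuous_map L X (\<lambda>x. x)" if "admissible_topology E X" for X
  proof -
    have "openin L {x \<in> topspace L. x \<in> U}" if "openin X U" for U
    proof -
      have "{x \<in> topspace L. x \<in> U} = U"
        using openin_subset[OF that] tsp[OF \<open>admissible_topology E X\<close>] tL by auto
      then show ?thesis
        using lc_inductive_limit_finest[OF \<open>admissible_topology E X\<close> that] by (simp add: L_def)
    qed
    then show ?thesis using tsp[OF that] tL by (auto simp: continuous_map_def)
  qed
  have cont: "continuous_map Y L f"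
    if c: "\<And>X. admissible_topology E X \<Longrightarrow> continuous_map Y X f" for f and Y :: "'z topology"
    unfolding L
  proof (rule continuous_on_generated_topo)
    fix U assume "U \<in> B"
    then obtain X where "admissible_topology E X" "openin X U" by (auto simp: B_def)
    then have "openin Y {x \<in> topspace Y. f x \<in> U}"
      using c by (auto simp: continuous_map_def)
    moreover have "{x \<in> topspace Y. f x \<in> U} = f -` U \<inter> topspace Y" by auto
    ultimately show "openin Y (f -` U \<inter> topspace Y)" by simp
  next
    show "f ` topspace Y \<subseteq> \<Union>B"
      using c[OF admissible_indiscrete[OF sub]] tsp[OF admissible_indiscrete[OF sub]] UB
      by (auto simp: continuous_map_def)
  qed
  have "generate_topology_on B U \<Longrightarrow> (\<lambda>_. 0) \<in> U \<Longrightarrow>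
      \<exists>C\<subseteq>U. seq_convex C \<and> (\<lambda>_. 0) \<in> L interior_of C" for U
  proof (induction rule: generate_topology_on.induct)
    case Empty
    then show ?case by simp
  next
    case (Int a b)
    then obtain C D where "C \<subseteq> a" "D \<subseteq> b" "seq_convex C" "seq_convex D"
      "(\<lambda>_. 0) \<in> L interior_of C" "(\<lambda>_. 0) \<in> L interior_of D" by auto
    then show ?case
      by (intro exI[of _ "C \<inter> D"]) (auto simp: interior_of_Int seq_convex_def)
  next
    case (UN K)
    then obtain k where k: "k \<in> K" "(\<lambda>_. 0) \<in> k" by auto
    then obtain C where "C \<subseteq> k" "seq_convex C" "(\<lambda>_. 0) \<in> L interior_of C"
      using UN by blast
    then show ?case using k by (intro exI[of _ C]) auto
  next
    case (Basis s)
    then obtain X where X: "admissible_topology E X" "openin X s" by (auto simp: B_def)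
    then obtain C where C: "C \<subseteq> s" "seq_convex C" "(\<lambda>_. 0) \<in> X interior_of C"
      using Basis(2) unfolding admissible_topology_def locally_convex_topology_def by blast
    then have "(\<lambda>_. 0) \<in> L interior_of C"
      using lc_inductive_limit_finest[OF X(1)] unfolding L_def interior_of_def by blast
    then show ?case using C by blast
  qed
  then have loc: "\<forall>U. openin L U \<and> (\<lambda>_. 0) \<in> U \<longrightarrow>
      (\<exists>C\<subseteq>U. seq_convex C \<and> (\<lambda>_. 0) \<in> L interior_of C)"
    by (simp add: L openin_topology_generated_by_iff)
  have "continuous_map (prod_topology L L) L (\<lambda>(x, y) j. x j + y j)"
  proof (rule cont)
    fix X assume X: "admissible_topology E X"
    have "continuous_map (prod_topology L L) (prod_topology X X) (\<lambda>(x, y). (x, y))"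
      unfolding case_prod_beta
      by (intro continuous_map_pairedI continuous_map_compose[OF _ idc[OF X], unfolded o_def]
            continuous_map_fst continuous_map_snd)
    moreover have "continuous_map (prod_topology X X) X (\<lambda>(x, y) j. x j + y j)"
      using X by (simp add: admissible_topology_def locally_convex_topology_def)
    ultimately show "continuous_map (prod_topology L L) X (\<lambda>(x, y) j. x j + y j)"
      using continuous_map_compose by (fastforce simp: o_def case_prod_beta)
  qed
  moreover have "continuous_map (prod_topology euclidean L) L (\<lambda>(c, x) j. c * x j)"
  proof (rule cont)
    fix X assume X: "admissible_topology E X"
    have "continuous_map (prod_topology euclidean L) (prod_topology euclidean X)
        (\<lambda>(c :: 'k, x). (c, x))"
      unfolding case_prod_beta
      by (intro continuous_map_pairedI continuous_map_compose[OF _ idc[OF X], unfolded o_def]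
            continuous_map_fst continuous_map_snd)
    moreover have "continuous_map (prod_topology euclidean X) X (\<lambda>(c, x) j. c * x j)"
      using X by (simp add: admissible_topology_def locally_convex_topology_def)
    ultimately show "continuous_map (prod_topology euclidean L) X (\<lambda>(c, x) j. c * x j)"
      using continuous_map_compose by (fastforce simp: o_def case_prod_beta)
  qed
  moreover have "continuous_map (E m) L (\<lambda>x. x)" for m
    by (rule cont) (simp add: admissible_topology_def)
  ultimately show ?thesis
    using tL loc sub by (simp add: admissible_topology_def locally_convex_topology_def S_def L_def)
qed

definition coechelon ::
    "real \<Rightarrow> (nat \<Rightarrow> nat \<Rightarrow> real) \<Rightarrow> (nat \<Rightarrow> 'k::real_normed_field) topology" where
  "coechelon p V = lc_inductive_limit (\<lambda>m. weighted_lp_topology p (V m))"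

definition backward_shift :: "(nat \<Rightarrow> 'a) \<Rightarrow> nat \<Rightarrow> 'a" where
  "backward_shift x = (\<lambda>j. x (Suc j))"

definition return_set :: "('a \<Rightarrow> 'a) \<Rightarrow> 'a set \<Rightarrow> 'a set \<Rightarrow> nat set" where
  "return_set T U W = {n. n \<ge> 1 \<and> (T ^^ n) ` U \<inter> W \<noteq> {}}"

definition transitive_on :: "'a topology \<Rightarrow> ('a \<Rightarrow> 'a) \<Rightarrow> bool" where
  "transitive_on E T \<longleftrightarrow>
     (\<forall>U W. openin E U \<and> U \<noteq> {} \<and> openin E W \<and> W \<noteq> {} \<longrightarrow> return_set T U W \<noteq> {})"

definition mixing_on :: "'a topology \<Rightarrow> ('a \<Rightarrow> 'a) \<Rightarrow> bool" where
  "mixing_on E T \<longleftrightarrow>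
     (\<forall>U W. openin E U \<and> U \<noteq> {} \<and> openin E W \<and> W \<noteq> {} \<longrightarrow> finite ({1..} - return_set T U W))"

definition periodic_points :: "'a topology \<Rightarrow> ('a \<Rightarrow> 'a) \<Rightarrow> 'a set" where
  "periodic_points E T = {x \<in> topspace E. \<exists>N\<ge>1. (T ^^ N) x = x}"

definition chaotic_on :: "'a topology \<Rightarrow> ('a \<Rightarrow> 'a) \<Rightarrow> bool" where
  "chaotic_on E T \<longleftrightarrow> transitive_on E T \<and> E closure_of periodic_points E T = topspace E"

definition sequentially_hypercyclic_on :: "'a topology \<Rightarrow> ('a \<Rightarrow> 'a) \<Rightarrow> bool" where
  "sequentially_hypercyclic_on E T \<longleftrightarrow>
     (\<exists>x\<in>topspace E. \<forall>y\<in>topspace E. \<exists>s.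
        range s \<subseteq> range (\<lambda>n. (T ^^ n) x) \<and> limitin E s y sequentially)"

end

theory Submission
  imports Defs
begin

text \<open>
  Write \<open>B\<close> and \<open>F\<close> for the backward and the forward shift. The inductive topology enters in two
  ways only: a sequence that converges in some step converges in the limit (\<open>coechelon_limit\<close>),
  and the coordinates are continuous (\<open>continuous_map_coechelon_coordinate\<close>).

  If \<open>x \<noteq> 0\<close> has period \<open>N\<close>, then \<open>x, B x, \<dots>, B\<^bsup>N - 1\<^esup> x\<close> lie in a common step \<open>m\<close>, and the sum
  of their absolute values is bounded below by a positive constant; hence \<open>v\<^sup>(\<^sup>m\<^sup>)\<close> itself belongs
  to \<open>\<ell>\<^sub>p\<close> or \<open>c\<^sub>0\<close> (\<open>nonzero_periodic_imp_weight\<close>). A chaotic \<open>B\<close> has such an \<open>x\<close>, because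
  \<open>{x. x\<^sub>0 \<noteq> 0}\<close> is open and nonempty (\<open>chaotic_imp_nonzero_periodic\<close>).

  Conversely, let \<open>v\<^sup>(\<^sup>m\<^sup>)\<close> belong to \<open>\<ell>\<^sub>p\<close> or \<open>c\<^sub>0\<close>. Then bounded sequences lie in the step \<open>m\<close>, and
  those that vanish on longer and longer initial segments, with a uniform bound, tend to zero there
  (\<open>coechelon_limit_bounded\<close>). Finitely supported vectors are dense. For such \<open>u\<close> and \<open>w\<close>, the
  vectors \<open>u + F\<^sup>n w\<close> tend to \<open>u\<close> and are mapped to \<open>w\<close> by \<open>B\<^sup>n\<close>, which gives mixing; the periodic
  extensions of \<open>u\<close> with growing period tend to \<open>u\<close>, which gives dense periodic points. A
  sequentially hypercyclic vector is \<open>x = \<Sum>\<^sub>l F\<^bsup>n l\<^esup> z\<^sub>l\<close>, where \<open>z\<close> runs through a countable dense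
  family of finitely supported vectors and \<open>n\<close> grows fast: \<open>B\<^bsup>n k\<^esup> x - z\<^sub>k\<close> tends to zero in
  the fixed step \<open>m\<close>, and so in every later step, while a given vector of any later step is a limit
  there of a subsequence of \<open>z\<close>.

  Norm estimates for infinite sums are avoided by a domination principle
  (\<open>lp_space_strictly_dominated\<close>): each \<open>a\<close> in \<open>\<ell>\<^sub>p\<close> or \<open>c\<^sub>0\<close> is \<open>o(b)\<close> for a positive \<open>b\<close> in the same
  space. It turns all the convergence claims into entrywise inequalities
  \<open>v\<^sub>j |s\<^sub>j - y\<^sub>j| \<le> \<epsilon> b\<^sub>j\<close> and treats \<open>p = 0\<close> and \<open>p \<ge> 1\<close> alike.
\<close>

section \<open>The sequence spaces and Minkowski's inequality\<close>

lemma powr_convex_nonneg: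
  fixes u v s t p :: real
  assumes "1 \<le> p" "0 \<le> u" "0 \<le> v" "0 \<le> s" "0 \<le> t" "s + t = 1"
  shows "(s * u + t * v) powr p \<le> s * u powr p + t * v powr p"
proof -
  have le_self: "r powr p \<le> r" if "0 \<le> r" "r \<le> 1" for r :: real
    using that assms(1) powr_mono'[of 1 p r] by (cases "r = 0") auto
  have scale: "(r * w) powr p \<le> r * w powr p" if "0 \<le> r" "r \<le> 1" "0 \<le> w" for r w :: real
    using le_self[OF that(1,2)] that by (simp add: powr_mult mult_right_mono)
  consider "u = 0" | "v = 0" | "0 < u" "0 < v" using assms by linarith
  then show ?thesis
  proof cases
    case 1
    then show ?thesis using scale[of t v] assms by auto
  next
    case 2
    then show ?thesis using scale[of s u] assms by auto
  next
    case 3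
    have s: "s = 1 - t" using assms(6) by simp
    have "((1 - t) *\<^sub>R u + t *\<^sub>R v) powr p \<le> (1 - t) * u powr p + t * v powr p"
      by (rule convex_onD[OF powr_convex[OF assms(1)]]) (use 3 assms s in auto)
    then show ?thesis by (simp add: s)
  qed
qed

lemma lp_space_dominated:
  assumes "b \<in> lp_space p" and "\<And>j. norm (a j) \<le> C * norm (b j)"
    and "p = 0 \<or> 1 \<le> p"
  shows "a \<in> lp_space p"
proof (cases "p = 0")
  case True
  then have "(\<lambda>j. C * norm (b j)) \<longlonglongrightarrow> 0"
    using assms(1) by (intro tendsto_mult_right_zero) (simp add: lp_space_def tendsto_norm_zero)
  then have "(\<lambda>j. norm (a j)) \<longlonglongrightarrow> 0"
    by (rule Lim_null_comparison[rotated]) (use assms(2) in simp)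
  then show ?thesis using True by (simp add: lp_space_def tendsto_norm_zero_iff)
next
  case False
  then have p: "1 \<le> p" using assms(3) by simp
  have "norm (a j) \<le> \<bar>C\<bar> * norm (b j)" for j
    using assms(2)[of j] by (meson abs_ge_self mult_right_mono norm_ge_zero order_trans)
  then have le: "norm (a j) powr p \<le> \<bar>C\<bar> powr p * norm (b j) powr p" for j
    using p by (metis abs_ge_zero norm_ge_zero powr_mono2 powr_mult order_trans zero_le_one)
  have "summable (\<lambda>j. \<bar>C\<bar> powr p * norm (b j) powr p)"
    using assms(1) False by (simp add: lp_space_def summable_mult)
  then have "summable (\<lambda>j. norm (a j) powr p)"
    by (rule summable_comparison_test'[where N=0]) (use le in simp)
  then show ?thesis using False by (simp add: lp_space_def)
qed

lemma lp_norm_dominated: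
  assumes "b \<in> lp_space p" and "\<And>j. norm (a j) \<le> C * norm (b j)"
    and "p = 0 \<or> 1 \<le> p" and "0 \<le> C"
  shows "lp_norm p a \<le> C * lp_norm p b"
proof (cases "p = 0")
  case True
  have "bdd_above (range (\<lambda>j. norm (b j)))"
    using assms(1) True convergent_imp_Bseq[OF convergentI]
    by (intro Bseq_bdd_above') (simp add: lp_space_def)
  then have "norm (b j) \<le> (SUP j. norm (b j))" for j
    by (rule cSUP_upper[rotated]) simp
  then have "norm (a j) \<le> C * (SUP j. norm (b j))" for j
    using assms(2)[of j] assms(4) by (meson mult_left_mono order_trans)
  then show ?thesis using True by (auto simp: lp_norm_def intro: cSUP_least)
next
  case False
  then have p: "1 \<le> p" using assms(3) by simp
  have "norm (a j) powr p \<le> C powr p * norm (b j) powr p" for j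
    using assms(2)[of j] p assms(4) by (metis norm_ge_zero powr_mono2 powr_mult order_trans zero_le_one)
  moreover have sb: "summable (\<lambda>j. norm (b j) powr p)"
    using assms(1) False by (simp add: lp_space_def)
  moreover have "summable (\<lambda>j. norm (a j) powr p)"
    using lp_space_dominated[OF assms(1-3)] False by (simp add: lp_space_def)
  ultimately have "(\<Sum>j. norm (a j) powr p) \<le> (\<Sum>j. C powr p * norm (b j) powr p)"
    by (intro suminf_le) (auto intro: summable_mult)
  also have "\<dots> = C powr p * (\<Sum>j. norm (b j) powr p)"
    using sb by (simp add: suminf_mult)
  finally have "(\<Sum>j. norm (a j) powr p) powr (1 / p)
      \<le> (C powr p * (\<Sum>j. norm (b j) powr p)) powr (1 / p)"
    using p \<open>summable (\<lambda>j. norm (a j) powr p)\<close> by (intro powr_mono2) (auto intro: suminf_nonneg)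
  also have "\<dots> = C * (\<Sum>j. norm (b j) powr p) powr (1 / p)"
    using p assms(4) sb by (simp add: powr_mult powr_powr suminf_nonneg)
  finally show ?thesis using False by (simp add: lp_norm_def)
qed

lemma lp_norm_cong: "(\<And>j. norm (a j) = norm (b j)) \<Longrightarrow> lp_norm p a = lp_norm p b"
  by (simp add: lp_norm_def)

lemma lp_norm_nonneg:
  assumes "a \<in> lp_space p" "p = 0 \<or> 1 \<le> p"
  shows "0 \<le> lp_norm p a"
proof -
  have "lp_norm p a \<le> 2 * lp_norm p a"
    by (rule lp_norm_dominated[OF assms(1) _ assms(2)]) simp_all
  then show ?thesis by simp
qed

lemma norm_le_lp_norm:
  assumes "a \<in> lp_space p" "p = 0 \<or> 1 \<le> p"
  shows "norm (a j) \<le> lp_norm p a"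
proof (cases "p = 0")
  case True
  have "bdd_above (range (\<lambda>j. norm (a j)))"
    using assms(1) True convergent_imp_Bseq[OF convergentI]
    by (intro Bseq_bdd_above') (simp add: lp_space_def)
  then show ?thesis using True by (auto simp: lp_norm_def intro: cSUP_upper)
next
  case False
  then have p: "1 \<le> p" using assms(2) by simp
  have s: "summable (\<lambda>j. norm (a j) powr p)" using assms(1) False by (simp add: lp_space_def)
  have "norm (a j) = (norm (a j) powr p) powr (1 / p)" using p by (simp add: powr_powr)
  also have "\<dots> \<le> (\<Sum>j. norm (a j) powr p) powr (1 / p)"
    using sum_le_suminf[OF s, of "{j}"] p by (intro powr_mono2) auto
  finally show ?thesis using False by (simp add: lp_norm_def)
qed

lemma lp_norm_eq_0_iff:
  assumes "a \<in> lp_space p" "p = 0 \<or> 1 \<le> p"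
  shows "lp_norm p a = 0 \<longleftrightarrow> a = (\<lambda>_. 0)"
proof
  assume "lp_norm p a = 0"
  then show "a = (\<lambda>_. 0)" using norm_le_lp_norm[OF assms] by auto
next
  assume "a = (\<lambda>_. 0)"
  then show "lp_norm p a = 0" using assms(2) by (auto simp: lp_norm_def)
qed

text \<open>
  Minkowski's inequality. For \<open>p \<ge> 1\<close> and \<open>A\<close>, \<open>B\<close> the norms of \<open>a\<close> and \<open>b\<close>, convexity of
  the \<open>p\<close>-th power bounds \<open>((|a\<^sub>j| + |b\<^sub>j|) / (A + B))\<^sup>p\<close> by the convex combination of
  \<open>(|a\<^sub>j| / A)\<^sup>p\<close> and \<open>(|b\<^sub>j| / B)\<^sup>p\<close> with weights \<open>A / (A + B)\<close> and \<open>B / (A + B)\<close>; both of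
  these have sum \<open>1\<close>.
\<close>

lemma lp_minkowski:
  assumes "a \<in> lp_space p" "b \<in> lp_space p" "p = 0 \<or> 1 \<le> p"
  shows "(\<lambda>j. a j + b j) \<in> lp_space p \<and> lp_norm p (\<lambda>j. a j + b j) \<le> lp_norm p a + lp_norm p b"
proof (cases "p = 0")
  case True
  have "norm (a j + b j) \<le> lp_norm p a + lp_norm p b" for j
    using norm_le_lp_norm[OF assms(1,3), of j] norm_le_lp_norm[OF assms(2,3), of j]
      norm_triangle_ineq[of "a j" "b j"] by linarith
  then have "(SUP j. norm (a j + b j)) \<le> lp_norm p a + lp_norm p b"
    by (intro cSUP_least) auto
  moreover have "(\<lambda>j. a j + b j) \<longlonglongrightarrow> 0"
    using assms(1,2) True tendsto_add_zero by (auto simp: lp_space_def)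
  ultimately show ?thesis using True by (simp add: lp_space_def lp_norm_def)
next
  case False
  then have p: "1 \<le> p" using assms(3) by simp
  define A where "A = lp_norm p a"
  define B where "B = lp_norm p b"
  consider "A = 0" | "B = 0" | "0 < A" "0 < B"
    using lp_norm_nonneg[OF assms(1,3)] lp_norm_nonneg[OF assms(2,3)] by (fastforce simp: A_def B_def)
  then show ?thesis
  proof cases
    case 1
    then have "a = (\<lambda>_. 0)" using lp_norm_eq_0_iff[OF assms(1,3)] by (simp add: A_def)
    then show ?thesis using assms 1 by (simp add: A_def)
  next
    case 2
    then have "b = (\<lambda>_. 0)" using lp_norm_eq_0_iff[OF assms(2,3)] by (simp add: B_def)
    then show ?thesis using assms 2 by (simp add: B_def)
  next
    case 3
    have sa: "summable (\<lambda>j. norm (a j) powr p)" and sb: "summable (\<lambda>j. norm (b j) powr p)"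
      using assms(1,2) False by (simp_all add: lp_space_def)
    have Ap: "(\<Sum>j. norm (a j) powr p) = A powr p" and Bp: "(\<Sum>j. norm (b j) powr p) = B powr p"
      using p False sa sb by (simp_all add: A_def B_def lp_norm_def powr_powr suminf_nonneg)
    define f where "f j = (A + B) powr p *
      (A / (A + B) * (norm (a j) powr p / A powr p) + B / (A + B) * (norm (b j) powr p / B powr p))" for j
    have le: "norm (a j + b j) powr p \<le> f j" for j
    proof -
      have "norm (a j + b j) powr p \<le> (norm (a j) + norm (b j)) powr p"
        using p by (intro powr_mono2 norm_triangle_ineq) auto
      also have "norm (a j) + norm (b j)
          = (A + B) * (A / (A + B) * (norm (a j) / A) + B / (A + B) * (norm (b j) / B))"
      proof -
        have "A / (A + B) * (norm (a j) / A) = norm (a j) / (A + B)"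
          "B / (A + B) * (norm (b j) / B) = norm (b j) / (A + B)"
          using 3 by simp_all
        then show ?thesis using 3 by (simp add: add_divide_distrib[symmetric])
      qed
      also have "\<dots> powr p = (A + B) powr p *
          (A / (A + B) * (norm (a j) / A) + B / (A + B) * (norm (b j) / B)) powr p"
        using 3 by (simp add: powr_mult)
      also have "\<dots> \<le> (A + B) powr p * (A / (A + B) * (norm (a j) / A) powr p
          + B / (A + B) * (norm (b j) / B) powr p)"
        using 3 p by (intro mult_left_mono powr_convex_nonneg) (auto simp: add_divide_distrib[symmetric])
      also have "\<dots> = f j" using 3 by (simp add: f_def powr_divide)
      finally show ?thesis .
    qed
    have "(\<lambda>j. norm (a j) powr p) sums (A powr p)" "(\<lambda>j. norm (b j) powr p) sums (B powr p)"
      using sa sb Ap Bp by (simp_all add: sums_iff)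
    then have "f sums ((A + B) powr p *
        (A / (A + B) * (A powr p / A powr p) + B / (A + B) * (B powr p / B powr p)))"
      unfolding f_def by (intro sums_mult sums_add sums_divide)
    moreover have "A / (A + B) * (A powr p / A powr p) + B / (A + B) * (B powr p / B powr p) = 1"
      using 3 by (simp add: add_divide_distrib[symmetric])
    ultimately have f: "f sums ((A + B) powr p)" by simp
    have s: "summable (\<lambda>j. norm (a j + b j) powr p)"
      by (rule summable_comparison_test'[OF sums_summable[OF f], where N=0]) (use le in auto)
    then have "(\<Sum>j. norm (a j + b j) powr p) \<le> (A + B) powr p"
      using suminf_le[OF le s sums_summable[OF f]] f by (simp add: sums_iff)
    then have "(\<Sum>j. norm (a j + b j) powr p) powr (1 / p) \<le> ((A + B) powr p) powr (1 / p)"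
      using p s by (intro powr_mono2) (auto intro: suminf_nonneg)
    then show ?thesis
      using s False 3 p by (simp add: lp_space_def lp_norm_def A_def B_def powr_powr)
  qed
qed

lemma lp_space_add:
  "a \<in> lp_space p \<Longrightarrow> b \<in> lp_space p \<Longrightarrow> p = 0 \<or> 1 \<le> p \<Longrightarrow> (\<lambda>j. a j + b j) \<in> lp_space p"
  by (rule lp_minkowski[THEN conjunct1])

lemma zero_in_lp_space: "p = 0 \<or> 1 \<le> p \<Longrightarrow> (\<lambda>_. 0) \<in> lp_space p"
  by (auto simp: lp_space_def)

lemma lp_space_finite_support:
  assumes "\<And>j. N \<le> j \<Longrightarrow> a j = 0" "p = 0 \<or> 1 \<le> p"
  shows "a \<in> lp_space p"
proof (cases "p = 0")
  case True
  have "a \<longlonglongrightarrow> 0"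
    by (rule tendsto_eventually) (use assms(1) eventually_sequentially in blast)
  then show ?thesis using True by (simp add: lp_space_def)
next
  case False
  have "summable (\<lambda>j. norm (a j) powr p)"
    by (rule summable_finite[of "{..<N}"]) (use assms in \<open>auto simp: not_less\<close>)
  then show ?thesis using False by (simp add: lp_space_def)
qed

text \<open>
  No element of the space decays most slowly: every \<open>a\<close> is \<open>o(b)\<close> for some positive \<open>b\<close> of the
  space. For \<open>p \<ge> 1\<close> this rests on Dini's theorem that \<open>\<Sum> c\<^sub>j / \<surd>r\<^sub>j\<close> converges for the
  tails \<open>r\<^sub>j\<close> of a convergent series \<open>\<Sum> c\<^sub>j\<close> of positive terms.
\<close>

lemma lp_space_strictly_dominated:
  assumes "a \<in> lp_space p" "p = 0 \<or> 1 \<le> p"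
  obtains b :: "nat \<Rightarrow> real" where "b \<in> lp_space p" "\<And>j. 0 < b j"
    "\<And>\<epsilon>. 0 < \<epsilon> \<Longrightarrow> \<exists>N. \<forall>j\<ge>N. norm (a j) \<le> \<epsilon> * b j"
proof (cases "p = 0")
  case True
  then have a: "(\<lambda>j. sqrt (norm (a j))) \<longlonglongrightarrow> 0"
    using assms(1) tendsto_real_sqrt[OF tendsto_norm_zero] by (fastforce simp: lp_space_def)
  show ?thesis
  proof
    show "(\<lambda>j. sqrt (norm (a j)) + inverse (real (Suc j))) \<in> lp_space p"
      using True tendsto_add_zero[OF a LIMSEQ_inverse_real_of_nat] by (simp add: lp_space_def)
    show "0 < sqrt (norm (a j)) + inverse (real (Suc j))" for j
      by (simp add: add_nonneg_pos)
    fix \<epsilon> :: real assume "0 < \<epsilon>"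
    then have "eventually (\<lambda>j. sqrt (norm (a j)) < \<epsilon>) sequentially"
      using a order_tendstoD(2) by blast
    then obtain N where N: "\<And>j. N \<le> j \<Longrightarrow> sqrt (norm (a j)) \<le> \<epsilon>"
      unfolding eventually_sequentially by (meson less_imp_le)
    have "norm (a j) \<le> \<epsilon> * (sqrt (norm (a j)) + inverse (real (Suc j)))" if "N \<le> j" for j
    proof -
      have "norm (a j) = sqrt (norm (a j)) * sqrt (norm (a j))" by simp
      also have "\<dots> \<le> \<epsilon> * (sqrt (norm (a j)) + inverse (real (Suc j)))"
        using N[OF that] \<open>0 < \<epsilon>\<close> by (intro mult_mono) auto
      finally show ?thesis .
    qed
    then show "\<exists>N. \<forall>j\<ge>N. norm (a j) \<le> \<epsilon> * (sqrt (norm (a j)) + inverse (real (Suc j)))" by blast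
  qed
next
  case False
  then have p: "1 \<le> p" using assms(2) by simp
  \<comment> \<open>The geometric term makes every \<open>c j\<close>, and hence every tail \<open>r j\<close>, positive.\<close>
  define c where "c j = norm (a j) powr p + (1 / 2) ^ j" for j
  define r where "r j = (\<Sum>i. c (i + j))" for j
  have "summable (\<lambda>j. norm (a j) powr p)" using assms(1) False by (simp add: lp_space_def)
  then have c: "summable c"
    unfolding c_def by (intro summable_add summable_geometric) auto
  have c0: "0 < c j" for j by (simp add: c_def add_nonneg_pos)
  have r0: "0 < r j" for j
    unfolding r_def using c c0 by (intro suminf_pos) (auto simp: summable_iff_shift)
  have rS: "r j = c j + r (Suc j)" for j
    using suminf_split_head[of "\<lambda>i. c (i + j)"] c by (simp add: r_def summable_iff_shift)
  have rlim: "r \<longlonglongrightarrow> 0"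
  proof (rule LIMSEQ_I)
    fix e :: real assume "0 < e"
    from suminf_exist_split[OF this c] show "\<exists>N. \<forall>n\<ge>N. norm (r n - 0) < e" by (simp add: r_def)
  qed
  have r'lim: "(\<lambda>j. sqrt (r j)) \<longlonglongrightarrow> 0" using tendsto_real_sqrt[OF rlim] by simp
  have le: "c j / sqrt (r j) \<le> 2 * (sqrt (r j) - sqrt (r (Suc j)))" for j
  proof -
    have "sqrt (r (Suc j)) \<le> sqrt (r j)" using rS[of j] c0[of j] by simp
    moreover have "c j = (sqrt (r j) - sqrt (r (Suc j))) * (sqrt (r j) + sqrt (r (Suc j)))"
    proof -
      have "sqrt (r j) * sqrt (r j) = r j" "sqrt (r (Suc j)) * sqrt (r (Suc j)) = r (Suc j)"
        using r0[of j] r0[of "Suc j"] by simp_all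
      then show ?thesis using rS[of j] by (simp add: algebra_simps)
    qed
    ultimately have "c j \<le> (sqrt (r j) - sqrt (r (Suc j))) * (2 * sqrt (r j))"
      by (smt (verit) mult_left_mono)
    then show ?thesis using r0[of j] by (simp add: divide_le_eq ac_simps)
  qed
  have "summable (\<lambda>j. 2 * (sqrt (r j) - sqrt (r (Suc j))))"
    using telescope_summable'[OF r'lim] by (rule summable_mult)
  then have s: "summable (\<lambda>j. c j / sqrt (r j))"
    by (rule summable_comparison_test'[where N=0]) (use le c0 r0 in \<open>auto simp: less_imp_le\<close>)
  define b where "b j = (c j / sqrt (r j)) powr (1 / p)" for j
  show ?thesis
  proof
    have "norm (b j) powr p = c j / sqrt (r j)" for j
      using p c0[of j] r0[of j] by (simp add: b_def powr_powr)
    then show "b \<in> lp_space p" using s False by (simp add: lp_space_def)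
    show "0 < b j" for j using c0[of j] r0[of j] by (simp add: b_def)
    fix \<epsilon> :: real assume e: "0 < \<epsilon>"
    then have "eventually (\<lambda>j. sqrt (r j) < \<epsilon> powr p) sequentially"
      using r'lim by (intro order_tendstoD(2)) auto
    then obtain N where N: "\<And>j. N \<le> j \<Longrightarrow> sqrt (r j) \<le> \<epsilon> powr p"
      unfolding eventually_sequentially by (meson less_imp_le)
    have "norm (a j) \<le> \<epsilon> * b j" if "N \<le> j" for j
    proof -
      have split: "c j = sqrt (r j) * (c j / sqrt (r j))" using r0[of j] by simp
      have "norm (a j) = (norm (a j) powr p) powr (1 / p)" using p by (simp add: powr_powr)
      also have "\<dots> \<le> (c j) powr (1 / p)" using p by (intro powr_mono2) (auto simp: c_def)
      also have "\<dots> = (sqrt (r j) * (c j / sqrt (r j))) powr (1 / p)"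
        by (rule arg_cong[OF split])
      also have "\<dots> \<le> (\<epsilon> powr p * (c j / sqrt (r j))) powr (1 / p)"
        using N[OF that] p c0[of j] r0[of j] by (intro powr_mono2 mult_right_mono) auto
      also have "\<dots> = (\<epsilon> powr p) powr (1 / p) * b j"
        unfolding b_def by (rule powr_mult)
      also have "\<dots> = \<epsilon> * b j" using e p by (simp add: powr_powr)
      finally show ?thesis .
    qed
    then show "\<exists>N. \<forall>j\<ge>N. norm (a j) \<le> \<epsilon> * b j" by blast
  qed
qed


section \<open>The weighted steps\<close>

lemma weighted_lp_dominated:
  fixes x y :: "nat \<Rightarrow> 'a::real_normed_vector"
  assumes "p = 0 \<or> 1 \<le> p" and "b \<in> lp_space p" and "\<And>j. 0 < v j"
    and "\<And>j. v j * norm (x j) \<le> C * norm (b j)"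
  shows "x \<in> weighted_lp p v"
  unfolding weighted_lp_def
proof (intro CollectI lp_space_dominated[OF assms(2) _ assms(1)])
  show "norm (weighted v x j) \<le> C * norm (b j)" for j
    using assms(3)[of j] assms(4)[of j] by (simp add: weighted_def)
qed

lemma weighted_lp_add:
  assumes "p = 0 \<or> 1 \<le> p" "x \<in> weighted_lp p v" "y \<in> weighted_lp p v"
  shows "(\<lambda>j. x j + y j) \<in> weighted_lp p v"
  using lp_space_add[of "weighted v x" p "weighted v y"] assms
  by (simp add: weighted_lp_def weighted_def scaleR_add_right)

lemma weighted_lp_mult:
  fixes x :: "nat \<Rightarrow> 'k::real_normed_field"
  assumes "p = 0 \<or> 1 \<le> p" "\<And>j. 0 < v j" "x \<in> weighted_lp p v"
  shows "(\<lambda>j. c * x j) \<in> weighted_lp p v"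
proof (rule weighted_lp_dominated[OF assms(1) _ assms(2)])
  show "weighted v x \<in> lp_space p" using assms(3) by (simp add: weighted_lp_def)
  show "v j * norm (c * x j) \<le> norm c * norm (weighted v x j)" for j
    using assms(2)[of j] by (simp add: weighted_def norm_mult)
qed

lemma weighted_lp_diff:
  assumes "p = 0 \<or> 1 \<le> p" "\<And>j. 0 < v j" "x \<in> weighted_lp p v" "y \<in> weighted_lp p v"
  shows "(\<lambda>j. x j - y j) \<in> weighted_lp p v"
proof -
  have "(\<lambda>j. - y j) \<in> weighted_lp p v"
  proof (rule weighted_lp_dominated[OF assms(1) _ assms(2)])
    show "weighted v y \<in> lp_space p" using assms(4) by (simp add: weighted_lp_def)
    show "v j * norm (- y j) \<le> 1 * norm (weighted v y j)" for j
      using assms(2)[of j] by (simp add: weighted_def)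
  qed
  then show ?thesis using weighted_lp_add[OF assms(1,3)] by fastforce
qed

lemma Metric_space_weighted_lp:
  assumes p: "p = 0 \<or> 1 \<le> p" and v: "\<And>j. 0 < v j"
  shows "Metric_space (weighted_lp p v) (weighted_lp_dist p v)"
proof
  fix x y :: "nat \<Rightarrow> 'a"
  have mem: "weighted v (\<lambda>j. x j - y j) \<in> lp_space p"
    if "x \<in> weighted_lp p v" "y \<in> weighted_lp p v" for x y :: "nat \<Rightarrow> 'a"
    using weighted_lp_diff[OF p v that] by (simp add: weighted_lp_def)
  show "0 \<le> weighted_lp_dist p v x y"
    using lp_norm_nonneg[OF mem p] by (simp add: weighted_lp_dist_def)
  show "weighted_lp_dist p v x y = weighted_lp_dist p v y x"
    unfolding weighted_lp_dist_def weighted_def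
    by (auto simp: norm_minus_commute intro!: lp_norm_cong)
  assume x: "x \<in> weighted_lp p v" and y: "y \<in> weighted_lp p v"
  have "v j \<noteq> 0" for j using v[of j] by simp
  then show "weighted_lp_dist p v x y = 0 \<longleftrightarrow> x = y"
    using lp_norm_eq_0_iff[OF mem[OF x y] p] x y
    by (auto simp: weighted_lp_dist_def weighted_def fun_eq_iff)
  fix z :: "nat \<Rightarrow> 'a" assume z: "z \<in> weighted_lp p v"
  have "weighted v (\<lambda>j. x j - z j) =
      (\<lambda>j. weighted v (\<lambda>j. x j - y j) j + weighted v (\<lambda>j. y j - z j) j)"
    by (simp add: weighted_def scaleR_add_right[symmetric])
  then show "weighted_lp_dist p v x z \<le> weighted_lp_dist p v x y + weighted_lp_dist p v y z"
    using lp_minkowski[OF mem[OF x y] mem[OF y z] p] x y z by (simp add: weighted_lp_dist_def)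
qed

lemma topspace_weighted_lp:
  assumes "p = 0 \<or> 1 \<le> p" "\<And>j. 0 < v j"
  shows "topspace (weighted_lp_topology p v) = weighted_lp p v"
  unfolding weighted_lp_topology_def
  by (rule Metric_space.topspace_mtopology[OF Metric_space_weighted_lp[OF assms]])

text \<open>
  Convergence in a step is always established through a dominating element \<open>b\<close> of the
  unweighted space.
\<close>

lemma weighted_lp_limit:
  fixes y :: "nat \<Rightarrow> 'a::real_normed_vector"
  assumes p: "p = 0 \<or> 1 \<le> p" and v: "\<And>j. 0 < v j"
    and y: "y \<in> weighted_lp p v" and b: "b \<in> lp_space p"
    and le: "\<And>\<epsilon>. 0 < \<epsilon> \<Longrightarrow>
      eventually (\<lambda>k. \<forall>j. v j * norm (s k j - y j) \<le> \<epsilon> * norm (b j)) sequentially"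
  shows "limitin (weighted_lp_topology p v) s y sequentially"
  unfolding weighted_lp_topology_def Metric_space.limitin_metric[OF Metric_space_weighted_lp[OF p v]]
proof (intro conjI allI impI y)
  fix \<epsilon> :: real assume "0 < \<epsilon>"
  define \<delta> where "\<delta> = \<epsilon> / (lp_norm p b + 1)"
  have b0: "0 \<le> lp_norm p b" by (rule lp_norm_nonneg[OF b p])
  have "0 < \<delta>" using \<open>0 < \<epsilon>\<close> b0 by (simp add: \<delta>_def)
  have "\<delta> * lp_norm p b < \<epsilon>"
    using \<open>0 < \<delta>\<close> b0 \<open>0 < \<epsilon>\<close> by (simp add: \<delta>_def divide_less_eq)
  show "eventually (\<lambda>k. s k \<in> weighted_lp p v \<and> weighted_lp_dist p v (s k) y < \<epsilon>) sequentially"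
    using le[OF \<open>0 < \<delta>\<close>]
  proof (rule eventually_mono)
    fix k assume k: "\<forall>j. v j * norm (s k j - y j) \<le> \<delta> * norm (b j)"
    have "(\<lambda>j. s k j - y j) \<in> weighted_lp p v"
      by (rule weighted_lp_dominated[OF p b v]) (use k in blast)
    then have s: "s k \<in> weighted_lp p v"
      using weighted_lp_add[OF p _ y, of "\<lambda>j. s k j - y j"] by simp
    have "lp_norm p (weighted v (\<lambda>j. s k j - y j)) \<le> \<delta> * lp_norm p b"
      by (rule lp_norm_dominated[OF b _ p])
        (use k v \<open>0 < \<delta>\<close> in \<open>simp_all add: weighted_def less_imp_le\<close>)
    then show "s k \<in> weighted_lp p v \<and> weighted_lp_dist p v (s k) y < \<epsilon>"
      using s y \<open>\<delta> * lp_norm p b < \<epsilon>\<close> by (simp add: weighted_lp_dist_def)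
  qed
qed

lemma continuous_map_step_coordinate:
  assumes p: "p = 0 \<or> 1 \<le> p" and v: "\<And>j. 0 < v j"
  shows "continuous_map (weighted_lp_topology p v :: (nat \<Rightarrow> 'a::real_normed_vector) topology)
    euclidean (\<lambda>x. x i)"
proof -
  interpret Metric_space "weighted_lp p v :: (nat \<Rightarrow> 'a) set" "weighted_lp_dist p v"
    by (rule Metric_space_weighted_lp[OF p v])
  have "\<exists>r>0. mball x r \<subseteq> {x \<in> weighted_lp p v. x i \<in> S}"
    if "open S" "x \<in> weighted_lp p v" "x i \<in> S" for S and x :: "nat \<Rightarrow> 'a"
  proof -
    obtain e where e: "0 < e" "ball (x i) e \<subseteq> S" using openE[OF \<open>open S\<close> \<open>x i \<in> S\<close>] .
    have "y i \<in> S" if y: "y \<in> weighted_lp p v" "weighted_lp_dist p v x y < e * v i" for y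
    proof -
      have "weighted v (\<lambda>j. x j - y j) \<in> lp_space p"
        using weighted_lp_diff[OF p v \<open>x \<in> weighted_lp p v\<close> y(1)] by (simp add: weighted_lp_def)
      from norm_le_lp_norm[OF this p, of i] have "v i * norm (x i - y i) \<le> weighted_lp_dist p v x y"
        using y(1) \<open>x \<in> weighted_lp p v\<close> v[of i] by (simp add: weighted_lp_dist_def weighted_def)
      then have "v i * norm (x i - y i) < e * v i" using y(2) by linarith
      then have "dist (x i) (y i) < e" using v[of i] by (simp add: dist_norm mult.commute[of e])
      then show ?thesis using e(2) by auto
    qed
    moreover have "0 < e * v i" using e(1) v by simp
    ultimately show ?thesis by (intro exI[of _ "e * v i"]) auto
  qed
  then show ?thesis
    unfolding weighted_lp_topology_def continuous_map_def
    by (auto simp: openin_mtopology)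
qed

lemma weighted_lp_antimono:
  assumes "p = 0 \<or> 1 \<le> p" "\<And>j. 0 < w j" "\<And>j. w j \<le> v j" "x \<in> weighted_lp p v"
  shows "x \<in> weighted_lp p w"
proof (rule weighted_lp_dominated[OF assms(1) _ assms(2)])
  show "weighted v x \<in> lp_space p" using assms(4) by (simp add: weighted_lp_def)
  show "w j * norm (x j) \<le> 1 * norm (weighted v x j)" for j
    using assms(2)[of j] assms(3)[of j] by (simp add: weighted_def mult_right_mono)
qed

lemma weighted_lp_finite_support:
  assumes "p = 0 \<or> 1 \<le> p" "\<And>j. N \<le> j \<Longrightarrow> x j = 0"
  shows "x \<in> weighted_lp p v"
  using lp_space_finite_support[of N "weighted v x"] assms by (simp add: weighted_lp_def weighted_def)

lemma weighted_lp_bounded: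
  assumes "p = 0 \<or> 1 \<le> p" "\<And>j. 0 < v j" "v \<in> lp_space p" "\<And>j. norm (x j) \<le> C"
  shows "x \<in> weighted_lp p v"
proof (rule weighted_lp_dominated[OF assms(1,3,2)])
  show "v j * norm (x j) \<le> C * norm (v j)" for j
    using assms(2)[of j] assms(4)[of j] by simp
qed


section \<open>Transitivity, shifts and finitely supported sequences\<close>

lemma mixing_imp_transitive:
  assumes "mixing_on E T"
  shows "transitive_on E T"
  unfolding transitive_on_def
proof (intro allI impI notI)
  fix U W assume "openin E U \<and> U \<noteq> {} \<and> openin E W \<and> W \<noteq> {}" and e: "return_set T U W = {}"
  then have "finite ({1..} - return_set T U W)" using assms unfolding mixing_on_def by blast
  then show False using e infinite_Ici[of "1::nat"] by simp
qed

lemma funpow_backward_shift: "(backward_shift ^^ n) x j = x (j + n)"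
  by (induction n arbitrary: x) (simp_all add: backward_shift_def funpow_swap1)

lemma finite_support_bounded:
  fixes u :: "nat \<Rightarrow> 'a::real_normed_vector"
  assumes "\<forall>j\<ge>N. u j = 0"
  obtains C where "0 \<le> C" "\<forall>j. norm (u j) \<le> C"
proof
  show "0 \<le> (\<Sum>i<N. norm (u i))" by (simp add: sum_nonneg)
  show "\<forall>j. norm (u j) \<le> (\<Sum>i<N. norm (u i))"
  proof
    show "norm (u j) \<le> (\<Sum>i<N. norm (u i))" for j
      using assms by (cases "j < N") (auto simp: sum_nonneg intro: member_le_sum)
  qed
qed

text \<open>
  A sequence of finitely supported vectors in which every finitely supported vector is
  approximated, arbitrarily late, entry by entry and on a prescribed support.
\<close>

lemma finite_support_enumeration:
  obtains z :: "nat \<Rightarrow> nat \<Rightarrow> 'a::{real_normed_vector, second_countable_topology}"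
  where "\<And>l. \<exists>N. \<forall>j\<ge>N. z l j = 0"
    and "\<And>y r N K. (\<forall>j. 0 < r j) \<Longrightarrow>
      \<exists>l\<ge>K. (\<forall>j<N. norm (z l j - y j) < r j) \<and> (\<forall>j\<ge>N. z l j = 0)"
proof -
  obtain D :: "'a set" where "countable D"
    and D: "\<And>X. open X \<Longrightarrow> X \<noteq> {} \<Longrightarrow> \<exists>d\<in>D. d \<in> X"
    by (rule countable_dense_setE) blast
  define d where "d = from_nat_into D"
  have "D \<noteq> {}" using D[of UNIV] by auto
  have dense: "\<exists>i. norm (d i - a) < \<epsilon>" if "0 < \<epsilon>" for a \<epsilon>
  proof -
    obtain c where "c \<in> D" "c \<in> ball a \<epsilon>" using D[of "ball a \<epsilon>"] \<open>0 < \<epsilon>\<close> by auto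
    moreover obtain i where "d i = c"
      using \<open>c \<in> D\<close> \<open>countable D\<close> from_nat_into_surj unfolding d_def by metis
    ultimately show ?thesis by (auto simp: dist_norm norm_minus_commute)
  qed
  \<comment> \<open>The second component of the index only serves to repeat each vector infinitely often.\<close>
  define entries :: "nat \<Rightarrow> nat list" where "entries l = from_nat (fst (prod_decode l))" for l
  define z where "z l j = (if j < length (entries l) then d (entries l ! j) else 0)" for l j
  show ?thesis
  proof
    show "\<exists>N. \<forall>j\<ge>N. z l j = 0" for l
      by (rule exI[of _ "length (entries l)"]) (simp add: z_def)
    fix y :: "nat \<Rightarrow> 'a" and r :: "nat \<Rightarrow> real" and N K :: nat
    assume "\<forall>j. 0 < r j"
    then have "\<forall>j. \<exists>i. norm (d i - y j) < r j" using dense by blast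
    then obtain i where i: "\<And>j. norm (d (i j) - y j) < r j" by metis
    define l where "l = prod_encode (to_nat (map i [0..<N]), K)"
    have e: "entries l = map i [0..<N]" by (simp add: entries_def l_def)
    have "K \<le> l" by (simp add: l_def le_prod_encode_2)
    moreover have "\<forall>j<N. norm (z l j - y j) < r j" using i by (simp add: z_def e)
    moreover have "\<forall>j\<ge>N. z l j = 0" by (simp add: z_def e)
    ultimately show "\<exists>l\<ge>K. (\<forall>j<N. norm (z l j - y j) < r j) \<and> (\<forall>j\<ge>N. z l j = 0)" by blast
  qed
qed

text \<open>
  Concatenation of blocks: block \<open>l\<close> occupies the positions from \<open>n l\<close> up to \<open>n (Suc l)\<close>.
\<close>

lemma concatenate_blocks:
  fixes n :: "nat \<Rightarrow> nat" and z :: "nat \<Rightarrow> nat \<Rightarrow> 'a"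
  assumes "strict_mono n" "n 0 = 0"
  obtains x where "\<And>j. \<exists>l. n l \<le> j \<and> j < n (Suc l) \<and> x j = z l (j - n l)"
proof
  define blk where "blk j = (LEAST l. j < n (Suc l))" for j
  show "\<exists>l. n l \<le> j \<and> j < n (Suc l) \<and> z (blk j) (j - n (blk j)) = z l (j - n l)" for j
  proof (intro exI[of _ "blk j"] conjI refl)
    have "j < n (Suc j)" using strict_mono_imp_increasing[OF assms(1), of "Suc j"] by simp
    then show "j < n (Suc (blk j))" unfolding blk_def by (rule LeastI)
    show "n (blk j) \<le> j"
    proof (cases "blk j")
      case (Suc l)
      then have "\<not> j < n (Suc l)" using not_less_Least[of l "\<lambda>l. j < n (Suc l)"] by (simp add: blk_def)
      then show ?thesis using Suc by simp
    qed (simp add: assms(2))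
  qed
qed


section \<open>The inductive limit\<close>

lemma decreasing_weights_pos: "decreasing_weights V \<Longrightarrow> 0 < V m j"
  by (simp add: decreasing_weights_def)

lemma decreasing_weights_mono: "decreasing_weights V \<Longrightarrow> m \<le> n \<Longrightarrow> V n j \<le> V m j"
  by (rule lift_Suc_antimono_le[of "\<lambda>m. V m j"]) (simp_all add: decreasing_weights_def)

context
  fixes V :: "nat \<Rightarrow> nat \<Rightarrow> real" and p :: real
  assumes V: "decreasing_weights V" and p: "p = 0 \<or> 1 \<le> p"
begin

lemmas V_pos = decreasing_weights_pos[OF V]

lemma weighted_lp_step_mono:
  "m \<le> n \<Longrightarrow> x \<in> weighted_lp p (V m) \<Longrightarrow> x \<in> weighted_lp p (V n)"
  by (rule weighted_lp_antimono[OF p V_pos decreasing_weights_mono[OF V]])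

lemma admissible_coechelon:
  "admissible_topology (\<lambda>m. weighted_lp_topology p (V m))
     (coechelon p V :: (nat \<Rightarrow> 'k::real_normed_field) topology)"
  unfolding coechelon_def
proof (rule admissible_lc_inductive_limit)
  let ?S = "\<Union>m. weighted_lp p (V m) :: (nat \<Rightarrow> 'k) set"
  have "seq_subspace ?S"
    unfolding seq_subspace_def
  proof (intro conjI ballI allI)
    have "(\<lambda>_. 0 :: 'k) \<in> weighted_lp p (V 0)"
      by (rule weighted_lp_finite_support[OF p, of 0]) (rule refl)
    then show "(\<lambda>_. 0) \<in> ?S" by blast
    show "(\<lambda>j. c * x j) \<in> ?S" if "x \<in> ?S" for c x
    proof -
      obtain m where "x \<in> weighted_lp p (V m)" using \<open>x \<in> ?S\<close> by blast
      then have "(\<lambda>j. c * x j) \<in> weighted_lp p (V m)" by (rule weighted_lp_mult[OF p V_pos])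
      then show ?thesis by blast
    qed
    fix x y assume "x \<in> ?S" "y \<in> ?S"
    then obtain m n where "x \<in> weighted_lp p (V m)" "y \<in> weighted_lp p (V n)" by blast
    then have "x \<in> weighted_lp p (V (max m n))" "y \<in> weighted_lp p (V (max m n))"
      by (auto intro: weighted_lp_step_mono max.cobounded1 max.cobounded2)
    then have "(\<lambda>j. x j + y j) \<in> weighted_lp p (V (max m n))" by (rule weighted_lp_add[OF p])
    then show "(\<lambda>j. x j + y j) \<in> ?S" by blast
  qed
  then show "seq_subspace (\<Union>m. topspace (weighted_lp_topology p (V m) :: (nat \<Rightarrow> 'k) topology))"
    by (simp add: topspace_weighted_lp[OF p V_pos])
qed

lemma topspace_coechelon:
  "topspace (coechelon p V :: (nat \<Rightarrow> 'k::real_normed_field) topology) = (\<Union>m. weighted_lp p (V m))"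
  using admissible_coechelon[where 'k='k] by (simp add: admissible_topology_def topspace_weighted_lp[OF p V_pos])

lemma coechelon_limit:
  fixes y :: "nat \<Rightarrow> 'k::real_normed_field"
  assumes "y \<in> weighted_lp p (V m)" and "b \<in> lp_space p"
    and "\<And>\<epsilon>. 0 < \<epsilon> \<Longrightarrow>
      eventually (\<lambda>k. \<forall>j. V m j * norm (s k j - y j) \<le> \<epsilon> * norm (b j)) sequentially"
  shows "limitin (coechelon p V) s y sequentially"
proof -
  have "continuous_map (weighted_lp_topology p (V m)) (coechelon p V :: (nat \<Rightarrow> 'k) topology) (\<lambda>x. x)"
    using admissible_coechelon[where 'k='k] by (simp add: admissible_topology_def)
  from continuous_map_limit[OF this weighted_lp_limit[OF p V_pos assms]]
  show ?thesis by (simp add: o_def)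
qed

text \<open>
  If \<open>v\<^sup>(\<^sup>m\<^sup>)\<close> belongs to the unweighted space, then uniformly bounded perturbations of \<open>y\<close> that
  fix more and more of its entries converge to \<open>y\<close>.
\<close>

lemma coechelon_limit_bounded:
  fixes y :: "nat \<Rightarrow> 'k::real_normed_field"
  assumes m: "V m \<in> lp_space p" and y: "y \<in> weighted_lp p (V m)"
    and eq: "\<And>k j. j < k \<Longrightarrow> s k j = y j" and C: "\<And>k j. norm (s k j - y j) \<le> C"
  shows "limitin (coechelon p V) s y sequentially"
proof -
  obtain b where b: "b \<in> lp_space p" "\<And>j. 0 < b j"
    and dom: "\<And>\<epsilon>. 0 < \<epsilon> \<Longrightarrow> \<exists>N. \<forall>j\<ge>N. norm (V m j) \<le> \<epsilon> * b j"
    by (rule lp_space_strictly_dominated[OF m p]) (rule that)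
  have "0 \<le> C" using C norm_ge_zero order_trans by blast
  show ?thesis
  proof (rule coechelon_limit[OF y b(1)])
    fix \<epsilon> :: real assume "0 < \<epsilon>"
    then have "0 < \<epsilon> / (C + 1)" using \<open>0 \<le> C\<close> by simp
    from dom[OF this] obtain N where N: "\<And>j. N \<le> j \<Longrightarrow> V m j \<le> \<epsilon> / (C + 1) * b j"
      by (auto simp: V_pos less_imp_le)
    have "V m j * norm (s k j - y j) \<le> \<epsilon> * norm (b j)" if "N \<le> k" for k j
    proof (cases "j < k")
      case True
      then show ?thesis using eq \<open>0 < \<epsilon>\<close> by simp
    next
      case False
      have "V m j * norm (s k j - y j) \<le> V m j * (C + 1)"
        using C[of k j] V_pos[of m j] by (intro mult_left_mono) auto
      also have "\<dots> \<le> \<epsilon> / (C + 1) * b j * (C + 1)"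
        using N[of j] False that \<open>0 \<le> C\<close> by (intro mult_right_mono) auto
      also have "\<dots> = \<epsilon> * norm (b j)" using \<open>0 \<le> C\<close> b(2)[of j] by simp
      finally show ?thesis .
    qed
    then show "eventually (\<lambda>k. \<forall>j. V m j * norm (s k j - y j) \<le> \<epsilon> * norm (b j)) sequentially"
      unfolding eventually_sequentially by blast
  qed
qed

text \<open>Truncations converge, so finitely supported sequences are dense.\<close>

lemma finite_support_dense:
  fixes U :: "(nat \<Rightarrow> 'k::real_normed_field) set"
  assumes "openin (coechelon p V) U" "U \<noteq> {}"
  obtains u N where "u \<in> U" "\<forall>j\<ge>N. u j = 0"
proof -
  obtain x m where x: "x \<in> U" "x \<in> weighted_lp p (V m)"
    using assms openin_subset[OF assms(1)] topspace_coechelon[where 'k='k] by blast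
  have "weighted (V m) x \<in> lp_space p" using x(2) by (simp add: weighted_lp_def)
  from lp_space_strictly_dominated[OF this p] obtain b :: "nat \<Rightarrow> real"
    where b: "b \<in> lp_space p" "\<And>j. 0 < b j"
    and dom: "\<And>\<epsilon>. 0 < \<epsilon> \<Longrightarrow> \<exists>N. \<forall>j\<ge>N. norm (weighted (V m) x j) \<le> \<epsilon> * b j"
    by blast
  define s where "s k j = (if j < k then x j else 0)" for k j :: nat
  have "limitin (coechelon p V) s x sequentially"
  proof (rule coechelon_limit[OF x(2) b(1)])
    fix \<epsilon> :: real assume "0 < \<epsilon>"
    from dom[OF this] obtain N where N: "\<And>j. N \<le> j \<Longrightarrow> norm (weighted (V m) x j) \<le> \<epsilon> * b j"
      by blast
    have "V m j * norm (s k j - x j) \<le> \<epsilon> * norm (b j)" if "N \<le> k" for k j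
      using N[of j] that b(2)[of j] V_pos[of m j] \<open>0 < \<epsilon>\<close> by (auto simp: s_def weighted_def)
    then show "eventually (\<lambda>k. \<forall>j. V m j * norm (s k j - x j) \<le> \<epsilon> * norm (b j)) sequentially"
      unfolding eventually_sequentially by blast
  qed
  then have "eventually (\<lambda>k. s k \<in> U) sequentially" using assms(1) x(1) by (auto simp: limitin_def)
  then obtain k where "s k \<in> U" using eventually_sequentially by auto
  then show ?thesis by (rule that[where N = k]) (simp add: s_def)
qed


section \<open>Mixing and periodic points\<close>

text \<open>
  For finitely supported \<open>u\<close> and \<open>w\<close>, the vectors \<open>u + F\<^sup>n w\<close> with \<open>F\<close> the forward shift
  converge to \<open>u\<close>, while the \<open>n\<close>-th iterate of the backward shift maps them to \<open>w\<close> for large \<open>n\<close>.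
\<close>

lemma mixing_on_coechelon:
  assumes m: "V m \<in> lp_space p"
  shows "mixing_on (coechelon p V :: (nat \<Rightarrow> 'k::real_normed_field) topology) backward_shift"
  unfolding mixing_on_def
proof (intro allI impI, elim conjE)
  fix U W :: "(nat \<Rightarrow> 'k) set"
  assume U: "openin (coechelon p V) U" "U \<noteq> {}" and W: "openin (coechelon p V) W" "W \<noteq> {}"
  obtain u M where u: "u \<in> U" "\<And>j. M \<le> j \<Longrightarrow> u j = 0" using finite_support_dense[OF U] by blast
  obtain w N where w: "w \<in> W" "\<And>j. N \<le> j \<Longrightarrow> w j = 0" using finite_support_dense[OF W] by blast
  obtain C where "0 \<le> C" and C: "\<And>j. norm (w j) \<le> C"
    using finite_support_bounded[of N w] w(2) by blast
  define s where "s n j = u j + (if j < n then 0 else w (j - n))" for n j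
  have "limitin (coechelon p V) s u sequentially"
    by (rule coechelon_limit_bounded[OF m weighted_lp_finite_support[OF p u(2)]])
      (use C \<open>0 \<le> C\<close> in \<open>auto simp: s_def\<close>)
  then have "eventually (\<lambda>n. s n \<in> U) sequentially" using U(1) u(1) by (auto simp: limitin_def)
  then obtain K where K: "\<And>n. K \<le> n \<Longrightarrow> s n \<in> U" unfolding eventually_sequentially by blast
  have "{1..} - return_set backward_shift U W \<subseteq> {..<max K M}"
  proof (intro subsetI, rule ccontr)
    fix n assume n: "n \<in> {1..} - return_set backward_shift U W" "n \<notin> {..<max K M}"
    have "(backward_shift ^^ n) (s n) = w"
      using n(2) u(2) by (auto simp: fun_eq_iff funpow_backward_shift s_def)
    then have "w \<in> (backward_shift ^^ n) ` U" using K[of n] n(2) by force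
    then show False using n(1) w(1) by (auto simp: return_set_def)
  qed
  then show "finite ({1..} - return_set backward_shift U W)"
    using finite_subset by blast
qed

text \<open>
  A sequence \<open>u\<close> supported in \<open>{..<N}\<close> is the limit of its periodizations with periods \<open>n \<ge> N\<close>.
\<close>

lemma periodic_points_dense:
  assumes m: "V m \<in> lp_space p"
  shows "coechelon p V closure_of
      periodic_points (coechelon p V :: (nat \<Rightarrow> 'k::real_normed_field) topology) backward_shift
    = topspace (coechelon p V)"
  unfolding dense_intersects_open
proof (intro allI impI, elim conjE)
  fix U :: "(nat \<Rightarrow> 'k) set"
  assume U: "openin (coechelon p V) U" "U \<noteq> {}"
  obtain u N where u: "u \<in> U" "\<And>j. N \<le> j \<Longrightarrow> u j = 0" using finite_support_dense[OF U] by blast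
  obtain C where C: "\<And>j. norm (u j) \<le> C" using finite_support_bounded[of N u] u(2) by blast
  define s where "s n j = u (j mod n)" for n j
  have "limitin (coechelon p V) s u sequentially"
  proof (rule coechelon_limit_bounded[OF m weighted_lp_finite_support[OF p u(2)]])
    show "norm (s n j - u j) \<le> C + C" for n j
      unfolding s_def using norm_triangle_ineq4 add_mono[OF C C] order_trans by blast
  qed (simp_all add: s_def)
  then have "eventually (\<lambda>n. s n \<in> U) sequentially" using U(1) u(1) by (auto simp: limitin_def)
  then obtain K where K: "\<And>n. K \<le> n \<Longrightarrow> s n \<in> U" unfolding eventually_sequentially by blast
  define n where "n = Suc K"
  have "s n \<in> weighted_lp p (V m)"
    by (rule weighted_lp_bounded[OF p V_pos m, where C = C]) (simp add: s_def C)
  moreover have "(backward_shift ^^ n) (s n) = s n"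
    by (simp add: fun_eq_iff funpow_backward_shift s_def)
  moreover have "1 \<le> n" by (simp add: n_def)
  ultimately have "s n \<in> periodic_points (coechelon p V) backward_shift"
    unfolding periodic_points_def topspace_coechelon by blast
  then show "periodic_points (coechelon p V) backward_shift \<inter> U \<noteq> {}"
    using K[of n] by (auto simp: n_def)
qed


section \<open>A sequentially dense orbit\<close>

text \<open>
  The blocks \<open>z\<^sub>l\<close> are placed so far apart that, after \<open>n\<^sub>k\<close> shifts, every later block lies where the
  weight \<open>v\<^sup>(\<^sup>m\<^sup>)\<close> is tiny compared with a sequence \<open>b\<close> chosen by
  \<open>lp_space_strictly_dominated\<close>. Hence \<open>B\<^bsup>n\<^sub>k\<^esup> x - z\<^sub>k\<close> tends to zero in the
  \<open>m\<close>-th step, and so in all later steps, whatever the step of the vector to be approximated.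
\<close>

lemma sequentially_hypercyclic_coechelon:
  assumes m: "V m \<in> lp_space p"
  shows "sequentially_hypercyclic_on
    (coechelon p V :: (nat \<Rightarrow> 'k::{real_normed_field, second_countable_topology}) topology)
    backward_shift"
proof -
  obtain b where b: "b \<in> lp_space p" "\<And>j. 0 < b j"
    and dom: "\<And>\<epsilon>. 0 < \<epsilon> \<Longrightarrow> \<exists>N. \<forall>j\<ge>N. norm (V m j) \<le> \<epsilon> * b j"
    by (rule lp_space_strictly_dominated[OF m p]) (rule that)
  obtain z :: "nat \<Rightarrow> nat \<Rightarrow> 'k" where z: "\<And>l. \<exists>N. \<forall>j\<ge>N. z l j = 0"
    and approx: "\<And>y r N K. (\<forall>j. 0 < r j) \<Longrightarrow>
      \<exists>l\<ge>K. (\<forall>j<N. norm (z l j - y j) < r j) \<and> (\<forall>j\<ge>N. z l j = 0)"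
    using finite_support_enumeration[where 'a = 'k] by blast
  obtain L where L: "\<And>l j. L l \<le> j \<Longrightarrow> z l j = 0" using z by metis
  have "\<exists>G. \<forall>j\<ge>G. \<forall>i. V m j * norm (z l i) \<le> inverse (real (Suc l)) * b j" for l
  proof -
    obtain C where "0 \<le> C" and C: "\<And>i. norm (z l i) \<le> C"
      using finite_support_bounded[of "L l" "z l"] L by blast
    define \<epsilon> where "\<epsilon> = inverse (real (Suc l)) / (C + 1)"
    have "0 < \<epsilon>" using \<open>0 \<le> C\<close> by (simp add: \<epsilon>_def)
    from dom[OF this] obtain G where G: "\<And>j. G \<le> j \<Longrightarrow> V m j \<le> \<epsilon> * b j"
      by (auto simp: V_pos less_imp_le)
    have "V m j * norm (z l i) \<le> inverse (real (Suc l)) * b j" if "G \<le> j" for i j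
    proof -
      have "V m j * norm (z l i) \<le> V m j * (C + 1)"
        using C[of i] V_pos[of m j] by (intro mult_left_mono) auto
      also have "\<dots> \<le> \<epsilon> * b j * (C + 1)"
        using G[OF that] \<open>0 \<le> C\<close> by (intro mult_right_mono) auto
      also have "\<dots> = inverse (real (Suc l)) * b j" using \<open>0 \<le> C\<close> by (simp add: \<epsilon>_def)
      finally show ?thesis .
    qed
    then show ?thesis by blast
  qed
  \<comment> \<open>Beyond position \<open>G l\<close>, any translate of \<open>z l\<close>, weighted by \<open>V m\<close>, is dominated by \<open>b / (l + 1)\<close>.\<close>
  then obtain G where G: "\<And>l i j. G l \<le> j \<Longrightarrow> V m j * norm (z l i) \<le> inverse (real (Suc l)) * b j"
    by metis
  \<comment> \<open>The distance from block \<open>l\<close> to block \<open>l + 1\<close> exceeds both the support length of \<open>z l\<close> and \<open>G (Suc l)\<close>.\<close>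
  define n where "n l = (\<Sum>i<l. Suc (L i + G (Suc i)))" for l
  have nS: "n (Suc l) = Suc (n l + L l + G (Suc l))" for l by (simp add: n_def)
  have "strict_mono n" by (rule strict_monoI_Suc) (simp add: nS)
  moreover have n0: "n 0 = 0" by (simp add: n_def)
  ultimately obtain x where x: "\<And>j. \<exists>l. n l \<le> j \<and> j < n (Suc l) \<and> x j = z l (j - n l)"
    using concatenate_blocks[of n z] by blast
  have mono: "k \<le> l \<Longrightarrow> n k \<le> n l" for k l
    using \<open>strict_mono n\<close> by (simp add: strict_mono_less_eq)
  have orbit: "V m j * norm (x (j + n k) - z k j) \<le> inverse (real (Suc k)) * b j" for k j
  proof -
    obtain l where l: "n l \<le> j + n k" "j + n k < n (Suc l)" "x (j + n k) = z l (j + n k - n l)"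
      using x by blast
    have "n k < n (Suc l)" using l(2) by linarith
    then have "k \<le> l" using mono[of "Suc l" k] by (meson leD not_less_eq_eq)
    show ?thesis
    proof (cases "k = l")
      case True
      then show ?thesis using l(3) b(2)[of j] by simp
    next
      case False
      then obtain i where i: "l = Suc i" "k \<le> i" using \<open>k \<le> l\<close> by (cases l) auto
      have "n (Suc i) \<le> j + n k" "n k \<le> n i" "n (Suc k) \<le> n (Suc i)"
        using l(1) i mono[of k i] mono[of "Suc k" "Suc i"] by simp_all
      then have "G l \<le> j" "L k \<le> j" unfolding i(1) using nS[of i] nS[of k] by linarith+
      then have "V m j * norm (x (j + n k) - z k j) \<le> inverse (real (Suc l)) * b j"
        using l(3) L[of k j] G[of l j] by simp
      also have "\<dots> \<le> inverse (real (Suc k)) * b j"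
        using \<open>k \<le> l\<close> b(2)[of j] by (intro mult_right_mono le_imp_inverse_le) auto
      finally show ?thesis .
    qed
  qed
  have "x \<in> weighted_lp p (V m)"
  proof -
    have "(\<lambda>j. x j - z 0 j) \<in> weighted_lp p (V m)"
      by (rule weighted_lp_dominated[OF p b(1) V_pos, where C = 1])
        (use orbit[of _ 0] n0 b(2) in \<open>simp add: less_imp_le\<close>)
    moreover have "z 0 \<in> weighted_lp p (V m)"
      by (rule weighted_lp_finite_support[OF p, of "L 0"]) (rule L)
    ultimately have "(\<lambda>j. x j - z 0 j + z 0 j) \<in> weighted_lp p (V m)"
      by (rule weighted_lp_add[OF p])
    then show ?thesis by simp
  qed
  then have "x \<in> topspace (coechelon p V)" by (auto simp: topspace_coechelon)
  moreover have "\<exists>s. range s \<subseteq> range (\<lambda>n. (backward_shift ^^ n) x) \<and>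
      limitin (coechelon p V) s y sequentially" if y_mem: "y \<in> topspace (coechelon p V)" for y
  proof -
    obtain m' where "y \<in> weighted_lp p (V m')" using y_mem by (auto simp: topspace_coechelon)
    \<comment> \<open>A common step of \<open>y\<close> and of the orbit of \<open>x\<close>.\<close>
    define q where "q = max m m'"
    have y: "y \<in> weighted_lp p (V q)"
      using weighted_lp_step_mono[OF _ \<open>y \<in> weighted_lp p (V m')\<close>] by (simp add: q_def)
    then have "weighted (V q) y \<in> lp_space p" by (simp add: weighted_lp_def)
    from lp_space_strictly_dominated[OF this p] obtain c :: "nat \<Rightarrow> real"
      where c: "c \<in> lp_space p" "\<And>j. 0 < c j"
      and domy: "\<And>\<epsilon>. 0 < \<epsilon> \<Longrightarrow> \<exists>N. \<forall>j\<ge>N. norm (weighted (V q) y j) \<le> \<epsilon> * c j"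
      by blast
    have "\<exists>l\<ge>i. \<forall>j. V q j * norm (z l j - y j) \<le> inverse (real (Suc i)) * c j" for i
    proof -
      have "0 < inverse (real (Suc i))" by simp
      from domy[OF this] obtain N
        where N: "\<And>j. N \<le> j \<Longrightarrow> V q j * norm (y j) \<le> inverse (real (Suc i)) * c j"
        by (auto simp: weighted_def V_pos less_imp_le)
      have "\<forall>j. 0 < inverse (real (Suc i)) * c j / V q j" using c(2) V_pos by simp
      from approx[OF this, of i N y] obtain l where l: "i \<le> l"
        "\<forall>j<N. norm (z l j - y j) < inverse (real (Suc i)) * c j / V q j" "\<forall>j\<ge>N. z l j = 0"
        by (elim exE conjE)
      have "V q j * norm (z l j - y j) \<le> inverse (real (Suc i)) * c j" for j
      proof (cases "j < N")
        case True
        have "norm (z l j - y j) * V q j < inverse (real (Suc i)) * c j"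
          using l(2)[rule_format, OF True] V_pos[of q j] by (simp only: pos_less_divide_eq)
        then show ?thesis by (simp add: mult.commute)
      next
        case False
        then show ?thesis using N[of j] l(3) by simp
      qed
      then show ?thesis using l(1) by blast
    qed
    then obtain l where l: "\<And>i. i \<le> l i"
      "\<And>i j. V q j * norm (z (l i) j - y j) \<le> inverse (real (Suc i)) * c j"
      by metis
    define s where "s i = (backward_shift ^^ n (l i)) x" for i
    have le: "V q j * norm (s i j - y j) \<le> inverse (real (Suc i)) * norm (b j + c j)" for i j
    proof -
      have "V q j * norm (s i j - y j)
          \<le> V q j * norm (s i j - z (l i) j) + V q j * norm (z (l i) j - y j)"
        using norm_triangle_ineq[of "s i j - z (l i) j" "z (l i) j - y j"] V_pos[of q j]
        by (simp add: distrib_left[symmetric])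
      also have "V q j * norm (s i j - z (l i) j) \<le> V m j * norm (s i j - z (l i) j)"
        using decreasing_weights_mono[OF V] by (intro mult_right_mono) (simp_all add: q_def)
      also have "\<dots> \<le> inverse (real (Suc (l i))) * b j"
        using orbit[of j "l i"] by (simp add: s_def funpow_backward_shift)
      also have "\<dots> \<le> inverse (real (Suc i)) * b j"
        using l(1)[of i] b(2)[of j] by (intro mult_right_mono le_imp_inverse_le) auto
      finally have "V q j * norm (s i j - y j)
          \<le> inverse (real (Suc i)) * b j + inverse (real (Suc i)) * c j"
        using l(2)[of j i] by linarith
      then show ?thesis using b(2)[of j] c(2)[of j] by (simp add: distrib_left)
    qed
    have "limitin (coechelon p V) s y sequentially"
    proof (rule coechelon_limit[OF y lp_space_add[OF b(1) c(1) p]])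
      fix \<epsilon> :: real assume "0 < \<epsilon>"
      then have "eventually (\<lambda>i. inverse (real (Suc i)) < \<epsilon>) sequentially"
        by (rule order_tendstoD(2)[OF LIMSEQ_inverse_real_of_nat])
      then show "eventually (\<lambda>i. \<forall>j. V q j * norm (s i j - y j) \<le> \<epsilon> * norm (b j + c j)) sequentially"
      proof (rule eventually_mono)
        fix i assume "inverse (real (Suc i)) < \<epsilon>"
        then have "inverse (real (Suc i)) * norm (b j + c j) \<le> \<epsilon> * norm (b j + c j)" for j
          by (intro mult_right_mono) auto
        then show "\<forall>j. V q j * norm (s i j - y j) \<le> \<epsilon> * norm (b j + c j)"
          using le order_trans by blast
      qed
    qed
    moreover have "range s \<subseteq> range (\<lambda>n. (backward_shift ^^ n) x)" by (auto simp: s_def)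
    ultimately show ?thesis by blast
  qed
  ultimately show ?thesis unfolding sequentially_hypercyclic_on_def by blast
qed


section \<open>Consequences of periodic points\<close>

text \<open>
  The coarsest topology making the coordinate \<open>x\<^sub>i\<close> continuous is admissible, so the coordinate is
  continuous on the inductive limit.
\<close>

lemma continuous_map_coechelon_coordinate:
  "continuous_map (coechelon p V :: (nat \<Rightarrow> 'k::real_normed_field) topology) euclidean (\<lambda>x. x i)"
proof -
  define S where "S = (\<Union>m. weighted_lp p (V m) :: (nat \<Rightarrow> 'k) set)"
  define X where "X = pullback_topology S (\<lambda>x. x i) euclidean"
  have tX: "topspace X = S" by (simp add: X_def topspace_pullback_topology)
  have "seq_subspace (topspace (coechelon p V :: (nat \<Rightarrow> 'k) topology))"
    using admissible_coechelon unfolding admissible_topology_def locally_convex_topology_def by blast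
  then have sub: "seq_subspace S" by (simp add: topspace_coechelon S_def)
  have into: "continuous_map Y X f"
    if "continuous_map Y euclidean (\<lambda>y. f y i)" "f ` topspace Y \<subseteq> S" for f and Y :: "'z topology"
    unfolding X_def by (rule continuous_map_pullback') (use that in \<open>auto simp: o_def\<close>)
  have coord: "continuous_map X euclidean (\<lambda>x. x i)"
    using continuous_map_pullback[of euclidean euclidean id S "\<lambda>x. x i"] by (simp add: X_def o_def)
  have "locally_convex_topology X"
    unfolding locally_convex_topology_def tX
  proof (intro conjI allI impI sub)
    have "continuous_map (prod_topology X X) euclidean (\<lambda>z. fst z i + snd z i)"
      by (intro continuous_map_add continuous_map_compose[OF continuous_map_fst coord, unfolded o_def]
          continuous_map_compose[OF continuous_map_snd coord, unfolded o_def])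
    then show "continuous_map (prod_topology X X) X (\<lambda>(x, y) j. x j + y j)"
      by (intro into) (use sub in \<open>auto simp: case_prod_beta seq_subspace_def tX\<close>)
    have "continuous_map (prod_topology euclidean X) euclidean (\<lambda>z. snd z i)"
      by (intro continuous_map_compose[OF continuous_map_snd coord, unfolded o_def])
    moreover have "continuous_map (prod_topology (euclidean :: 'k topology) X) euclidean fst"
      by (rule continuous_map_fst)
    ultimately have "continuous_map (prod_topology euclidean X) euclidean (\<lambda>z. fst z * snd z i)"
      unfolding continuous_map_atin by (auto intro!: tendsto_mult)
    then show "continuous_map (prod_topology euclidean X) X (\<lambda>(c, x) j. c * x j)"
      by (intro into) (use sub in \<open>auto simp: case_prod_beta seq_subspace_def tX\<close>)
    fix U assume U: "openin X U \<and> (\<lambda>_. 0) \<in> U"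
    then obtain O' where O': "open O'" "U = (\<lambda>x. x i) -` O' \<inter> S"
      by (auto simp: X_def openin_pullback_topology)
    then obtain r where r: "0 < r" "ball 0 r \<subseteq> O'" using openE[OF O'(1), of 0] U by auto
    define C where "C = (\<lambda>x. x i) -` ball 0 r \<inter> S"
    have "openin X C" unfolding X_def openin_pullback_topology C_def by (metis open_ball open_openin)
    have "seq_convex C"
      unfolding seq_convex_def
    proof (intro ballI)
      fix x y and t :: real assume x: "x \<in> C" and y: "y \<in> C" and t: "t \<in> {0..1}"
      have "(\<lambda>j. of_real (1 - t) * x j) \<in> S" "(\<lambda>j. of_real t * y j) \<in> S"
        using sub x y unfolding seq_subspace_def C_def by blast+
      then have "(\<lambda>j. of_real (1 - t) * x j + of_real t * y j) \<in> S"
        using sub unfolding seq_subspace_def by fast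
      moreover have "(1 - t) *\<^sub>R x i + t *\<^sub>R y i \<in> ball 0 r"
        by (rule convexD[OF convex_ball]) (use x y t in \<open>auto simp: C_def\<close>)
      ultimately show "(\<lambda>j. (1 - t) *\<^sub>R x j + t *\<^sub>R y j) \<in> C"
        by (simp add: C_def scaleR_conv_of_real)
    qed
    moreover have "(\<lambda>_. 0) \<in> X interior_of C"
      using \<open>openin X C\<close> sub r(1) by (simp add: interior_of_openin C_def seq_subspace_def)
    moreover have "C \<subseteq> U" using r(2) O'(2) by (auto simp: C_def)
    ultimately show "\<exists>C\<subseteq>U. seq_convex C \<and> (\<lambda>_. 0) \<in> X interior_of C" by blast
  qed
  moreover have "continuous_map (weighted_lp_topology p (V m)) X (\<lambda>x. x)" for m
    by (rule into[OF continuous_map_step_coordinate[OF p V_pos]])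
      (auto simp: topspace_weighted_lp[OF p V_pos] S_def)
  ultimately have "admissible_topology (\<lambda>m. weighted_lp_topology p (V m)) X"
    by (simp add: admissible_topology_def tX topspace_weighted_lp[OF p V_pos] S_def)
  then have open_coechelon: "openin (coechelon p V) U" if "openin X U" for U
    unfolding coechelon_def using that by (rule lc_inductive_limit_finest)
  show ?thesis
    using coord open_coechelon by (simp add: continuous_map_def tX topspace_coechelon S_def)
qed

text \<open>Density forces a periodic point into the open set of all \<open>x\<close> with \<open>x\<^sub>0 \<noteq> 0\<close>.\<close>

lemma chaotic_imp_nonzero_periodic:
  assumes "chaotic_on (coechelon p V :: (nat \<Rightarrow> 'k::real_normed_field) topology) T"
  shows "\<exists>x\<in>periodic_points (coechelon p V :: (nat \<Rightarrow> 'k) topology) T. x \<noteq> (\<lambda>_. 0)"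
proof -
  define E where "E = (coechelon p V :: (nat \<Rightarrow> 'k) topology)"
  define U where "U = {x \<in> topspace E. x 0 \<in> - {0}}"
  have "openin E U"
    unfolding U_def E_def
    by (rule openin_continuous_map_preimage[OF continuous_map_coechelon_coordinate])
      (simp add: open_Compl flip: open_openin)
  moreover have "(\<lambda>j. if j = 0 then 1 else 0) \<in> weighted_lp p (V 0)"
    by (rule weighted_lp_finite_support[OF p, of 1]) simp
  then have "U \<noteq> {}" by (auto simp: U_def E_def topspace_coechelon)
  ultimately have "periodic_points E T \<inter> U \<noteq> {}"
    using assms unfolding chaotic_on_def dense_intersects_open E_def by blast
  then show ?thesis unfolding U_def E_def by fastforce
qed

text \<open>
  If \<open>x\<close> has period \<open>N\<close> and \<open>x\<^sub>i \<noteq> 0\<close>, then every window of \<open>N\<close> consecutive entries of \<open>x\<close> contains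
  the value \<open>x\<^sub>i\<close>. Hence the sum of \<open>|x|, |B x|, \<dots>, |B\<^bsup>N - 1\<^esup> x|\<close>, which lies in a single step,
  is bounded below by \<open>|x\<^sub>i|\<close>.
\<close>

lemma nonzero_periodic_imp_weight:
  fixes x :: "nat \<Rightarrow> 'k::real_normed_field"
  assumes B: "\<And>y :: nat \<Rightarrow> 'k. y \<in> topspace (coechelon p V) \<Longrightarrow> backward_shift y \<in> topspace (coechelon p V)"
    and x: "x \<in> periodic_points (coechelon p V) backward_shift" and "x \<noteq> (\<lambda>_. 0)"
  shows "\<exists>m. V m \<in> lp_space p"
proof -
  obtain N where N: "1 \<le> N" "(backward_shift ^^ N) x = x" and "x \<in> topspace (coechelon p V)"
    using x by (auto simp: periodic_points_def)
  obtain i where i: "x i \<noteq> 0" using \<open>x \<noteq> (\<lambda>_. 0)\<close> by auto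
  have per: "x (j + q * N) = x j" for j q
  proof (induction q)
    case (Suc q)
    have "x (j + q * N + N) = x (j + q * N)" by (metis N(2) funpow_backward_shift)
    then show ?case using Suc by (simp add: algebra_simps)
  qed simp
  have window: "\<exists>k<N. x (j + k) = x i" for j
  proof (intro exI[of _ "(i + j * N - j) mod N"] conjI)
    let ?t = "i + j * N - j"
    have "j \<le> i + j * N" using N(1) by (simp add: trans_le_add2)
    then have "j + ?t mod N + ?t div N * N = i + j * N"
      by (metis add.assoc le_add_diff_inverse mod_div_mult_eq)
    then show "x (j + ?t mod N) = x i" by (metis per)
    show "?t mod N < N" using N(1) by simp
  qed
  have "(backward_shift ^^ k) x \<in> topspace (coechelon p V)" for k
    by (induction k) (use \<open>x \<in> topspace (coechelon p V)\<close> B in auto)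
  then have "\<forall>k. \<exists>m. (backward_shift ^^ k) x \<in> weighted_lp p (V m)"
    by (simp add: topspace_coechelon)
  then obtain f where f: "\<And>k. (backward_shift ^^ k) x \<in> weighted_lp p (V (f k))" by metis
  define m where "m = (\<Sum>k<N. f k)"
  have step: "(backward_shift ^^ k) x \<in> weighted_lp p (V m)" if "k < N" for k
  proof (rule weighted_lp_step_mono[OF _ f])
    show "f k \<le> m" unfolding m_def by (rule member_le_sum) (use that in auto)
  qed
  have sum: "(\<lambda>j. \<Sum>k<K. V m j * norm (x (j + k))) \<in> lp_space p" if "K \<le> N" for K
    using that
  proof (induction K)
    case 0
    then show ?case using zero_in_lp_space[OF p] by simp
  next
    case (Suc K)
    have "weighted (V m) ((backward_shift ^^ K) x) \<in> lp_space p"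
      using step[of K] Suc.prems by (simp add: weighted_lp_def)
    then have "(\<lambda>j. V m j * norm (x (j + K))) \<in> lp_space p"
      by (rule lp_space_dominated[where C = 1])
        (use p V_pos in \<open>auto simp: weighted_def funpow_backward_shift less_imp_le\<close>)
    then show ?case using lp_space_add[OF Suc.IH _ p] Suc.prems by simp
  qed
  have "V m \<in> lp_space p"
  proof (rule lp_space_dominated[OF sum[OF order_refl] _ p])
    fix j
    obtain k where k: "k < N" "x (j + k) = x i" using window by blast
    have "V m j * norm (x i) = V m j * norm (x (j + k))" using k(2) by simp
    also have "\<dots> \<le> (\<Sum>k<N. V m j * norm (x (j + k)))"
      by (rule member_le_sum) (use k(1) V_pos in \<open>auto simp: less_imp_le\<close>)
    also have "\<dots> \<le> norm (\<Sum>k<N. V m j * norm (x (j + k)))" by simp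
    finally show "norm (V m j) \<le> inverse (norm (x i)) * norm (\<Sum>k<N. V m j * norm (x (j + k)))"
      using i V_pos[of m j] by (simp add: field_simps)
  qed
  then show ?thesis ..
qed

end

theorem proposition3p3:
  fixes V :: "nat \<Rightarrow> nat \<Rightarrow> real" and p :: real
    and E :: "(nat \<Rightarrow> 'k::{real_normed_field, euclidean_space}) topology"
  assumes "decreasing_weights V"
    and "p = 0 \<or> 1 \<le> p"
    and "E = coechelon p V"
    and "continuous_map E E backward_shift"
  shows "((\<exists>x\<in>periodic_points E backward_shift. x \<noteq> (\<lambda>_. 0)) \<longleftrightarrow> (\<exists>m. V m \<in> lp_space p)) \<and>
    ((\<exists>m. V m \<in> lp_space p) \<longleftrightarrow>
       chaotic_on E backward_shift \<and> mixing_on E backward_shift \<and>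
       sequentially_hypercyclic_on E backward_shift) \<and>
    (chaotic_on E backward_shift \<and> mixing_on E backward_shift \<and>
       sequentially_hypercyclic_on E backward_shift \<longleftrightarrow> chaotic_on E backward_shift) \<and>
    (chaotic_on E backward_shift \<longrightarrow> sequentially_hypercyclic_on E backward_shift)"
proof -
  note V = assms(1) and p = assms(2) and E = assms(3)
  have B: "backward_shift y \<in> topspace E" if "y \<in> topspace E" for y
    using assms(4) that by (auto simp: continuous_map_def)
  have 1: "\<exists>m. V m \<in> lp_space p" if "\<exists>x\<in>periodic_points E backward_shift. x \<noteq> (\<lambda>_. 0)"
    using nonzero_periodic_imp_weight[OF V p B[unfolded E]] that unfolding E by blast
  have 2: "mixing_on E backward_shift" "chaotic_on E backward_shift"
    "sequentially_hypercyclic_on E backward_shift" if ex: "\<exists>m. V m \<in> lp_space p"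
  proof -
    obtain m where m: "V m \<in> lp_space p" using ex ..
    show mix: "mixing_on E backward_shift" unfolding E by (rule mixing_on_coechelon[OF V p m])
    show "chaotic_on E backward_shift"
      using mixing_imp_transitive[OF mix] periodic_points_dense[OF V p m]
      unfolding chaotic_on_def E by blast
    show "sequentially_hypercyclic_on E backward_shift"
      unfolding E by (rule sequentially_hypercyclic_coechelon[OF V p m])
  qed
  have 3: "\<exists>x\<in>periodic_points E backward_shift. x \<noteq> (\<lambda>_. 0)" if "chaotic_on E backward_shift"
    using chaotic_imp_nonzero_periodic[OF V p that[unfolded E]] unfolding E .
  show ?thesis using 1 2 3 by blast
qed

end
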